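(* Let $X$ be a type, $f:X\to X$ and $I:\prod_{x:X}(f(f(x))=f(x))$. Suppose $f$ is weakly constant, i.e. we have $\prod_{x,y:X}(f(x)=f(y))$. Then $f$ has a splitting. That is, there exist a type $A$, maps $r:X\to A$ and $s:A\to X$, and homotopies $H:\prod_{a:A}(r(s(a))=a)$ and $K:\prod_{x:X}(s(r(x))=f(x))$.
   Context: Intensional Martin-Löf type theory; no extensionality axioms are assumed. *)

theory Defs
  imports Main
begin

text \<open>
  Intensional Martin-Loef type theory with dependent products, dependent sums, coproducts, the
  empty type, the unit type, natural numbers, identity types and a cumulative hierarchy of
  Russell-style universes, presented by contexts, typing and typed judgemental equality. There is
  no reflection rule, no function extensionality and no univalence. Judgemental eta rules are left
  out as well: whatever is derivable here is derivable in the variants that have them.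

  Raw terms use de Bruijn indices. Number of variables bound in the arguments:
  one in the second argument of \<open>Pi\<close>, \<open>Lam\<close> and \<open>Sigma\<close>;
  one in the motive (first argument) of every eliminator, except three in that of \<open>IdInd\<close>
  (index 2 and 1 are the two points, index 0 is the identification between them);
  two in the branch of \<open>SigmaInd\<close> and in the successor branch of \<open>NatInd\<close>
  (index 1 is the first component resp. the predecessor, index 0 is the second component resp. the
  recursive value); one in the branches of \<open>PlusInd\<close> and in the branch of \<open>IdInd\<close>.
\<close>

datatype tm =
    Var nat
  | Univ nat
  | Pi tm tm | Lam tm tm | App tm tm
  | Sigma tm tm | Pr tm tm | SigmaInd tm tm tm
  | Plus tm tm | InL tm | InR tm | PlusInd tm tm tm tm
  | Empty | EmptyInd tm tm
  | Unit | Star | UnitInd tm tm tm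
  | NatT | ZeroT | SucT tm | NatInd tm tm tm tm
  | IdT tm tm tm | Refl tm | IdInd tm tm tm tm tm

definition scons :: "'a \<Rightarrow> (nat \<Rightarrow> 'a) \<Rightarrow> nat \<Rightarrow> 'a"  (infixr "\<cdot>" 65) where
  "(a \<cdot> \<sigma>) n = (case n of 0 \<Rightarrow> a | Suc m \<Rightarrow> \<sigma> m)"

definition upr :: "(nat \<Rightarrow> nat) \<Rightarrow> nat \<Rightarrow> nat" where
  "upr \<rho> = 0 \<cdot> (\<lambda>n. Suc (\<rho> n))"

primrec ren :: "tm \<Rightarrow> (nat \<Rightarrow> nat) \<Rightarrow> tm" where
  "ren (Var n) \<rho> = Var (\<rho> n)"
| "ren (Univ i) \<rho> = Univ i"
| "ren (Pi A B) \<rho> = Pi (ren A \<rho>) (ren B (upr \<rho>))"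
| "ren (Lam A b) \<rho> = Lam (ren A \<rho>) (ren b (upr \<rho>))"
| "ren (App f a) \<rho> = App (ren f \<rho>) (ren a \<rho>)"
| "ren (Sigma A B) \<rho> = Sigma (ren A \<rho>) (ren B (upr \<rho>))"
| "ren (Pr a b) \<rho> = Pr (ren a \<rho>) (ren b \<rho>)"
| "ren (SigmaInd C g p) \<rho> = SigmaInd (ren C (upr \<rho>)) (ren g (upr (upr \<rho>))) (ren p \<rho>)"
| "ren (Plus A B) \<rho> = Plus (ren A \<rho>) (ren B \<rho>)"
| "ren (InL a) \<rho> = InL (ren a \<rho>)"
| "ren (InR b) \<rho> = InR (ren b \<rho>)"
| "ren (PlusInd C c d e) \<rho> =
    PlusInd (ren C (upr \<rho>)) (ren c (upr \<rho>)) (ren d (upr \<rho>)) (ren e \<rho>)"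
| "ren Empty \<rho> = Empty"
| "ren (EmptyInd C a) \<rho> = EmptyInd (ren C (upr \<rho>)) (ren a \<rho>)"
| "ren Unit \<rho> = Unit"
| "ren Star \<rho> = Star"
| "ren (UnitInd C c a) \<rho> = UnitInd (ren C (upr \<rho>)) (ren c \<rho>) (ren a \<rho>)"
| "ren NatT \<rho> = NatT"
| "ren ZeroT \<rho> = ZeroT"
| "ren (SucT n) \<rho> = SucT (ren n \<rho>)"
| "ren (NatInd C c d n) \<rho> =
    NatInd (ren C (upr \<rho>)) (ren c \<rho>) (ren d (upr (upr \<rho>))) (ren n \<rho>)"
| "ren (IdT A a b) \<rho> = IdT (ren A \<rho>) (ren a \<rho>) (ren b \<rho>)"
| "ren (Refl a) \<rho> = Refl (ren a \<rho>)"
| "ren (IdInd C c a b p) \<rho> =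
    IdInd (ren C (upr (upr (upr \<rho>)))) (ren c (upr \<rho>)) (ren a \<rho>) (ren b \<rho>) (ren p \<rho>)"

abbreviation wk :: "tm \<Rightarrow> tm" where
  "wk t \<equiv> ren t Suc"

definition ups :: "(nat \<Rightarrow> tm) \<Rightarrow> nat \<Rightarrow> tm" where
  "ups \<sigma> = Var 0 \<cdot> (\<lambda>n. wk (\<sigma> n))"

primrec subst :: "tm \<Rightarrow> (nat \<Rightarrow> tm) \<Rightarrow> tm"  ("_\<langle>_\<rangle>" [1000, 0] 1000) where
  "(Var n)\<langle>\<sigma>\<rangle> = \<sigma> n"
| "(Univ i)\<langle>\<sigma>\<rangle> = Univ i"
| "(Pi A B)\<langle>\<sigma>\<rangle> = Pi (A\<langle>\<sigma>\<rangle>) (B\<langle>ups \<sigma>\<rangle>)"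
| "(Lam A b)\<langle>\<sigma>\<rangle> = Lam (A\<langle>\<sigma>\<rangle>) (b\<langle>ups \<sigma>\<rangle>)"
| "(App f a)\<langle>\<sigma>\<rangle> = App (f\<langle>\<sigma>\<rangle>) (a\<langle>\<sigma>\<rangle>)"
| "(Sigma A B)\<langle>\<sigma>\<rangle> = Sigma (A\<langle>\<sigma>\<rangle>) (B\<langle>ups \<sigma>\<rangle>)"
| "(Pr a b)\<langle>\<sigma>\<rangle> = Pr (a\<langle>\<sigma>\<rangle>) (b\<langle>\<sigma>\<rangle>)"
| "(SigmaInd C g p)\<langle>\<sigma>\<rangle> = SigmaInd (C\<langle>ups \<sigma>\<rangle>) (g\<langle>ups (ups \<sigma>)\<rangle>) (p\<langle>\<sigma>\<rangle>)"
| "(Plus A B)\<langle>\<sigma>\<rangle> = Plus (A\<langle>\<sigma>\<rangle>) (B\<langle>\<sigma>\<rangle>)"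
| "(InL a)\<langle>\<sigma>\<rangle> = InL (a\<langle>\<sigma>\<rangle>)"
| "(InR b)\<langle>\<sigma>\<rangle> = InR (b\<langle>\<sigma>\<rangle>)"
| "(PlusInd C c d e)\<langle>\<sigma>\<rangle> = PlusInd (C\<langle>ups \<sigma>\<rangle>) (c\<langle>ups \<sigma>\<rangle>) (d\<langle>ups \<sigma>\<rangle>) (e\<langle>\<sigma>\<rangle>)"
| "Empty\<langle>\<sigma>\<rangle> = Empty"
| "(EmptyInd C a)\<langle>\<sigma>\<rangle> = EmptyInd (C\<langle>ups \<sigma>\<rangle>) (a\<langle>\<sigma>\<rangle>)"
| "Unit\<langle>\<sigma>\<rangle> = Unit"
| "Star\<langle>\<sigma>\<rangle> = Star"
| "(UnitInd C c a)\<langle>\<sigma>\<rangle> = UnitInd (C\<langle>ups \<sigma>\<rangle>) (c\<langle>\<sigma>\<rangle>) (a\<langle>\<sigma>\<rangle>)"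
| "NatT\<langle>\<sigma>\<rangle> = NatT"
| "ZeroT\<langle>\<sigma>\<rangle> = ZeroT"
| "(SucT n)\<langle>\<sigma>\<rangle> = SucT (n\<langle>\<sigma>\<rangle>)"
| "(NatInd C c d n)\<langle>\<sigma>\<rangle> = NatInd (C\<langle>ups \<sigma>\<rangle>) (c\<langle>\<sigma>\<rangle>) (d\<langle>ups (ups \<sigma>)\<rangle>) (n\<langle>\<sigma>\<rangle>)"
| "(IdT A a b)\<langle>\<sigma>\<rangle> = IdT (A\<langle>\<sigma>\<rangle>) (a\<langle>\<sigma>\<rangle>) (b\<langle>\<sigma>\<rangle>)"
| "(Refl a)\<langle>\<sigma>\<rangle> = Refl (a\<langle>\<sigma>\<rangle>)"
| "(IdInd C c a b p)\<langle>\<sigma>\<rangle> =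
    IdInd (C\<langle>ups (ups (ups \<sigma>))\<rangle>) (c\<langle>ups \<sigma>\<rangle>) (a\<langle>\<sigma>\<rangle>) (b\<langle>\<sigma>\<rangle>) (p\<langle>\<sigma>\<rangle>)"

abbreviation Arr :: "tm \<Rightarrow> tm \<Rightarrow> tm" where
  "Arr A B \<equiv> Pi A (wk B)"

text \<open>
  A context is a list of types, most recent first. A substitution of the form
  \<open>t \<cdot> (\<lambda>k. Var (k + n))\<close> instantiates index 0 by a term \<open>t\<close> that lives in the context
  extended by \<open>n\<close> further variables.
\<close>

inductive is_ctx :: "tm list \<Rightarrow> bool"
  and has_type :: "tm list \<Rightarrow> tm \<Rightarrow> tm \<Rightarrow> bool"  ("_ \<turnstile> _ \<Ztypecolon> _" [50, 51, 51] 50)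
  and jeq :: "tm list \<Rightarrow> tm \<Rightarrow> tm \<Rightarrow> tm \<Rightarrow> bool"  ("_ \<turnstile> _ \<doteq> _ \<Ztypecolon> _" [50, 51, 51, 51] 50)
where
  ctx_emp: "is_ctx []"
| ctx_ext: "\<Gamma> \<turnstile> A \<Ztypecolon> Univ i \<Longrightarrow> is_ctx (A # \<Gamma>)"

| var: "is_ctx \<Gamma> \<Longrightarrow> n < length \<Gamma> \<Longrightarrow> \<Gamma> \<turnstile> Var n \<Ztypecolon> ren (\<Gamma> ! n) (\<lambda>k. k + Suc n)"
| conv: "\<Gamma> \<turnstile> a \<Ztypecolon> A \<Longrightarrow> \<Gamma> \<turnstile> A \<doteq> B \<Ztypecolon> Univ i \<Longrightarrow> \<Gamma> \<turnstile> a \<Ztypecolon> B"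
| eq_refl: "\<Gamma> \<turnstile> a \<Ztypecolon> A \<Longrightarrow> \<Gamma> \<turnstile> a \<doteq> a \<Ztypecolon> A"
| eq_sym: "\<Gamma> \<turnstile> a \<doteq> b \<Ztypecolon> A \<Longrightarrow> \<Gamma> \<turnstile> b \<doteq> a \<Ztypecolon> A"
| eq_trans: "\<Gamma> \<turnstile> a \<doteq> b \<Ztypecolon> A \<Longrightarrow> \<Gamma> \<turnstile> b \<doteq> c \<Ztypecolon> A \<Longrightarrow> \<Gamma> \<turnstile> a \<doteq> c \<Ztypecolon> A"
| eq_conv: "\<Gamma> \<turnstile> a \<doteq> b \<Ztypecolon> A \<Longrightarrow> \<Gamma> \<turnstile> A \<doteq> B \<Ztypecolon> Univ i \<Longrightarrow> \<Gamma> \<turnstile> a \<doteq> b \<Ztypecolon> B"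

| univ_intro: "is_ctx \<Gamma> \<Longrightarrow> \<Gamma> \<turnstile> Univ i \<Ztypecolon> Univ (Suc i)"
| univ_cumul: "\<Gamma> \<turnstile> A \<Ztypecolon> Univ i \<Longrightarrow> \<Gamma> \<turnstile> A \<Ztypecolon> Univ (Suc i)"
| univ_cumul_eq: "\<Gamma> \<turnstile> A \<doteq> B \<Ztypecolon> Univ i \<Longrightarrow> \<Gamma> \<turnstile> A \<doteq> B \<Ztypecolon> Univ (Suc i)"

| pi_form: "\<Gamma> \<turnstile> A \<Ztypecolon> Univ i \<Longrightarrow> A # \<Gamma> \<turnstile> B \<Ztypecolon> Univ i \<Longrightarrow> \<Gamma> \<turnstile> Pi A B \<Ztypecolon> Univ i"
| pi_intro: "\<Gamma> \<turnstile> A \<Ztypecolon> Univ i \<Longrightarrow> A # \<Gamma> \<turnstile> b \<Ztypecolon> B \<Longrightarrow> \<Gamma> \<turnstile> Lam A b \<Ztypecolon> Pi A B"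
| pi_elim: "\<Gamma> \<turnstile> f \<Ztypecolon> Pi A B \<Longrightarrow> \<Gamma> \<turnstile> a \<Ztypecolon> A \<Longrightarrow> \<Gamma> \<turnstile> App f a \<Ztypecolon> B\<langle>a \<cdot> Var\<rangle>"
| pi_comp: "A # \<Gamma> \<turnstile> b \<Ztypecolon> B \<Longrightarrow> \<Gamma> \<turnstile> a \<Ztypecolon> A \<Longrightarrow>
    \<Gamma> \<turnstile> App (Lam A b) a \<doteq> b\<langle>a \<cdot> Var\<rangle> \<Ztypecolon> B\<langle>a \<cdot> Var\<rangle>"
| pi_form_cong: "\<Gamma> \<turnstile> A \<Ztypecolon> Univ i \<Longrightarrow> \<Gamma> \<turnstile> A \<doteq> A' \<Ztypecolon> Univ i \<Longrightarrow> A # \<Gamma> \<turnstile> B \<doteq> B' \<Ztypecolon> Univ i \<Longrightarrow>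
    \<Gamma> \<turnstile> Pi A B \<doteq> Pi A' B' \<Ztypecolon> Univ i"
| pi_intro_cong: "\<Gamma> \<turnstile> A \<Ztypecolon> Univ i \<Longrightarrow> \<Gamma> \<turnstile> A \<doteq> A' \<Ztypecolon> Univ i \<Longrightarrow> A # \<Gamma> \<turnstile> b \<doteq> b' \<Ztypecolon> B \<Longrightarrow>
    \<Gamma> \<turnstile> Lam A b \<doteq> Lam A' b' \<Ztypecolon> Pi A B"
| pi_elim_cong: "\<Gamma> \<turnstile> f \<doteq> f' \<Ztypecolon> Pi A B \<Longrightarrow> \<Gamma> \<turnstile> a \<doteq> a' \<Ztypecolon> A \<Longrightarrow>
    \<Gamma> \<turnstile> App f a \<doteq> App f' a' \<Ztypecolon> B\<langle>a \<cdot> Var\<rangle>"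

| sigma_form: "\<Gamma> \<turnstile> A \<Ztypecolon> Univ i \<Longrightarrow> A # \<Gamma> \<turnstile> B \<Ztypecolon> Univ i \<Longrightarrow> \<Gamma> \<turnstile> Sigma A B \<Ztypecolon> Univ i"
| sigma_intro: "A # \<Gamma> \<turnstile> B \<Ztypecolon> Univ i \<Longrightarrow> \<Gamma> \<turnstile> a \<Ztypecolon> A \<Longrightarrow> \<Gamma> \<turnstile> b \<Ztypecolon> B\<langle>a \<cdot> Var\<rangle> \<Longrightarrow>
    \<Gamma> \<turnstile> Pr a b \<Ztypecolon> Sigma A B"
| sigma_elim: "Sigma A B # \<Gamma> \<turnstile> C \<Ztypecolon> Univ i \<Longrightarrow>
    B # A # \<Gamma> \<turnstile> g \<Ztypecolon> C\<langle>Pr (Var 1) (Var 0) \<cdot> (\<lambda>k. Var (k + 2))\<rangle> \<Longrightarrow>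
    \<Gamma> \<turnstile> p \<Ztypecolon> Sigma A B \<Longrightarrow>
    \<Gamma> \<turnstile> SigmaInd C g p \<Ztypecolon> C\<langle>p \<cdot> Var\<rangle>"
| sigma_comp: "Sigma A B # \<Gamma> \<turnstile> C \<Ztypecolon> Univ i \<Longrightarrow>
    B # A # \<Gamma> \<turnstile> g \<Ztypecolon> C\<langle>Pr (Var 1) (Var 0) \<cdot> (\<lambda>k. Var (k + 2))\<rangle> \<Longrightarrow>
    \<Gamma> \<turnstile> a \<Ztypecolon> A \<Longrightarrow> \<Gamma> \<turnstile> b \<Ztypecolon> B\<langle>a \<cdot> Var\<rangle> \<Longrightarrow>
    \<Gamma> \<turnstile> SigmaInd C g (Pr a b) \<doteq> g\<langle>b \<cdot> a \<cdot> Var\<rangle> \<Ztypecolon> C\<langle>Pr a b \<cdot> Var\<rangle>"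
| sigma_form_cong: "\<Gamma> \<turnstile> A \<Ztypecolon> Univ i \<Longrightarrow> \<Gamma> \<turnstile> A \<doteq> A' \<Ztypecolon> Univ i \<Longrightarrow> A # \<Gamma> \<turnstile> B \<doteq> B' \<Ztypecolon> Univ i \<Longrightarrow>
    \<Gamma> \<turnstile> Sigma A B \<doteq> Sigma A' B' \<Ztypecolon> Univ i"
| sigma_intro_cong: "A # \<Gamma> \<turnstile> B \<Ztypecolon> Univ i \<Longrightarrow> \<Gamma> \<turnstile> a \<doteq> a' \<Ztypecolon> A \<Longrightarrow> \<Gamma> \<turnstile> b \<doteq> b' \<Ztypecolon> B\<langle>a \<cdot> Var\<rangle> \<Longrightarrow>
    \<Gamma> \<turnstile> Pr a b \<doteq> Pr a' b' \<Ztypecolon> Sigma A B"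
| sigma_elim_cong: "Sigma A B # \<Gamma> \<turnstile> C \<doteq> C' \<Ztypecolon> Univ i \<Longrightarrow>
    B # A # \<Gamma> \<turnstile> g \<doteq> g' \<Ztypecolon> C\<langle>Pr (Var 1) (Var 0) \<cdot> (\<lambda>k. Var (k + 2))\<rangle> \<Longrightarrow>
    \<Gamma> \<turnstile> p \<doteq> p' \<Ztypecolon> Sigma A B \<Longrightarrow>
    \<Gamma> \<turnstile> SigmaInd C g p \<doteq> SigmaInd C' g' p' \<Ztypecolon> C\<langle>p \<cdot> Var\<rangle>"

| plus_form: "\<Gamma> \<turnstile> A \<Ztypecolon> Univ i \<Longrightarrow> \<Gamma> \<turnstile> B \<Ztypecolon> Univ i \<Longrightarrow> \<Gamma> \<turnstile> Plus A B \<Ztypecolon> Univ i"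
| plus_introl: "\<Gamma> \<turnstile> A \<Ztypecolon> Univ i \<Longrightarrow> \<Gamma> \<turnstile> B \<Ztypecolon> Univ i \<Longrightarrow> \<Gamma> \<turnstile> a \<Ztypecolon> A \<Longrightarrow> \<Gamma> \<turnstile> InL a \<Ztypecolon> Plus A B"
| plus_intror: "\<Gamma> \<turnstile> A \<Ztypecolon> Univ i \<Longrightarrow> \<Gamma> \<turnstile> B \<Ztypecolon> Univ i \<Longrightarrow> \<Gamma> \<turnstile> b \<Ztypecolon> B \<Longrightarrow> \<Gamma> \<turnstile> InR b \<Ztypecolon> Plus A B"
| plus_elim: "Plus A B # \<Gamma> \<turnstile> C \<Ztypecolon> Univ i \<Longrightarrow>
    A # \<Gamma> \<turnstile> c \<Ztypecolon> C\<langle>InL (Var 0) \<cdot> (\<lambda>k. Var (k + 1))\<rangle> \<Longrightarrow>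
    B # \<Gamma> \<turnstile> d \<Ztypecolon> C\<langle>InR (Var 0) \<cdot> (\<lambda>k. Var (k + 1))\<rangle> \<Longrightarrow>
    \<Gamma> \<turnstile> e \<Ztypecolon> Plus A B \<Longrightarrow>
    \<Gamma> \<turnstile> PlusInd C c d e \<Ztypecolon> C\<langle>e \<cdot> Var\<rangle>"
| plus_compl: "Plus A B # \<Gamma> \<turnstile> C \<Ztypecolon> Univ i \<Longrightarrow>
    A # \<Gamma> \<turnstile> c \<Ztypecolon> C\<langle>InL (Var 0) \<cdot> (\<lambda>k. Var (k + 1))\<rangle> \<Longrightarrow>
    B # \<Gamma> \<turnstile> d \<Ztypecolon> C\<langle>InR (Var 0) \<cdot> (\<lambda>k. Var (k + 1))\<rangle> \<Longrightarrow>
    \<Gamma> \<turnstile> a \<Ztypecolon> A \<Longrightarrow>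
    \<Gamma> \<turnstile> PlusInd C c d (InL a) \<doteq> c\<langle>a \<cdot> Var\<rangle> \<Ztypecolon> C\<langle>InL a \<cdot> Var\<rangle>"
| plus_compr: "Plus A B # \<Gamma> \<turnstile> C \<Ztypecolon> Univ i \<Longrightarrow>
    A # \<Gamma> \<turnstile> c \<Ztypecolon> C\<langle>InL (Var 0) \<cdot> (\<lambda>k. Var (k + 1))\<rangle> \<Longrightarrow>
    B # \<Gamma> \<turnstile> d \<Ztypecolon> C\<langle>InR (Var 0) \<cdot> (\<lambda>k. Var (k + 1))\<rangle> \<Longrightarrow>
    \<Gamma> \<turnstile> b \<Ztypecolon> B \<Longrightarrow>
    \<Gamma> \<turnstile> PlusInd C c d (InR b) \<doteq> d\<langle>b \<cdot> Var\<rangle> \<Ztypecolon> C\<langle>InR b \<cdot> Var\<rangle>"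
| plus_form_cong: "\<Gamma> \<turnstile> A \<doteq> A' \<Ztypecolon> Univ i \<Longrightarrow> \<Gamma> \<turnstile> B \<doteq> B' \<Ztypecolon> Univ i \<Longrightarrow>
    \<Gamma> \<turnstile> Plus A B \<doteq> Plus A' B' \<Ztypecolon> Univ i"
| plus_introl_cong: "\<Gamma> \<turnstile> A \<Ztypecolon> Univ i \<Longrightarrow> \<Gamma> \<turnstile> B \<Ztypecolon> Univ i \<Longrightarrow> \<Gamma> \<turnstile> a \<doteq> a' \<Ztypecolon> A \<Longrightarrow>
    \<Gamma> \<turnstile> InL a \<doteq> InL a' \<Ztypecolon> Plus A B"
| plus_intror_cong: "\<Gamma> \<turnstile> A \<Ztypecolon> Univ i \<Longrightarrow> \<Gamma> \<turnstile> B \<Ztypecolon> Univ i \<Longrightarrow> \<Gamma> \<turnstile> b \<doteq> b' \<Ztypecolon> B \<Longrightarrow>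
    \<Gamma> \<turnstile> InR b \<doteq> InR b' \<Ztypecolon> Plus A B"
| plus_elim_cong: "Plus A B # \<Gamma> \<turnstile> C \<doteq> C' \<Ztypecolon> Univ i \<Longrightarrow>
    A # \<Gamma> \<turnstile> c \<doteq> c' \<Ztypecolon> C\<langle>InL (Var 0) \<cdot> (\<lambda>k. Var (k + 1))\<rangle> \<Longrightarrow>
    B # \<Gamma> \<turnstile> d \<doteq> d' \<Ztypecolon> C\<langle>InR (Var 0) \<cdot> (\<lambda>k. Var (k + 1))\<rangle> \<Longrightarrow>
    \<Gamma> \<turnstile> e \<doteq> e' \<Ztypecolon> Plus A B \<Longrightarrow>
    \<Gamma> \<turnstile> PlusInd C c d e \<doteq> PlusInd C' c' d' e' \<Ztypecolon> C\<langle>e \<cdot> Var\<rangle>"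

| empty_form: "is_ctx \<Gamma> \<Longrightarrow> \<Gamma> \<turnstile> Empty \<Ztypecolon> Univ i"
| empty_elim: "Empty # \<Gamma> \<turnstile> C \<Ztypecolon> Univ i \<Longrightarrow> \<Gamma> \<turnstile> a \<Ztypecolon> Empty \<Longrightarrow> \<Gamma> \<turnstile> EmptyInd C a \<Ztypecolon> C\<langle>a \<cdot> Var\<rangle>"
| empty_elim_cong: "Empty # \<Gamma> \<turnstile> C \<doteq> C' \<Ztypecolon> Univ i \<Longrightarrow> \<Gamma> \<turnstile> a \<doteq> a' \<Ztypecolon> Empty \<Longrightarrow>
    \<Gamma> \<turnstile> EmptyInd C a \<doteq> EmptyInd C' a' \<Ztypecolon> C\<langle>a \<cdot> Var\<rangle>"

| unit_form: "is_ctx \<Gamma> \<Longrightarrow> \<Gamma> \<turnstile> Unit \<Ztypecolon> Univ i"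
| unit_intro: "is_ctx \<Gamma> \<Longrightarrow> \<Gamma> \<turnstile> Star \<Ztypecolon> Unit"
| unit_elim: "Unit # \<Gamma> \<turnstile> C \<Ztypecolon> Univ i \<Longrightarrow> \<Gamma> \<turnstile> c \<Ztypecolon> C\<langle>Star \<cdot> Var\<rangle> \<Longrightarrow> \<Gamma> \<turnstile> a \<Ztypecolon> Unit \<Longrightarrow>
    \<Gamma> \<turnstile> UnitInd C c a \<Ztypecolon> C\<langle>a \<cdot> Var\<rangle>"
| unit_comp: "Unit # \<Gamma> \<turnstile> C \<Ztypecolon> Univ i \<Longrightarrow> \<Gamma> \<turnstile> c \<Ztypecolon> C\<langle>Star \<cdot> Var\<rangle> \<Longrightarrow>
    \<Gamma> \<turnstile> UnitInd C c Star \<doteq> c \<Ztypecolon> C\<langle>Star \<cdot> Var\<rangle>"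
| unit_elim_cong: "Unit # \<Gamma> \<turnstile> C \<doteq> C' \<Ztypecolon> Univ i \<Longrightarrow> \<Gamma> \<turnstile> c \<doteq> c' \<Ztypecolon> C\<langle>Star \<cdot> Var\<rangle> \<Longrightarrow>
    \<Gamma> \<turnstile> a \<doteq> a' \<Ztypecolon> Unit \<Longrightarrow>
    \<Gamma> \<turnstile> UnitInd C c a \<doteq> UnitInd C' c' a' \<Ztypecolon> C\<langle>a \<cdot> Var\<rangle>"

| nat_form: "is_ctx \<Gamma> \<Longrightarrow> \<Gamma> \<turnstile> NatT \<Ztypecolon> Univ i"
| nat_intro0: "is_ctx \<Gamma> \<Longrightarrow> \<Gamma> \<turnstile> ZeroT \<Ztypecolon> NatT"
| nat_introS: "\<Gamma> \<turnstile> n \<Ztypecolon> NatT \<Longrightarrow> \<Gamma> \<turnstile> SucT n \<Ztypecolon> NatT"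
| nat_elim: "NatT # \<Gamma> \<turnstile> C \<Ztypecolon> Univ i \<Longrightarrow> \<Gamma> \<turnstile> c \<Ztypecolon> C\<langle>ZeroT \<cdot> Var\<rangle> \<Longrightarrow>
    C # NatT # \<Gamma> \<turnstile> d \<Ztypecolon> C\<langle>SucT (Var 1) \<cdot> (\<lambda>k. Var (k + 2))\<rangle> \<Longrightarrow>
    \<Gamma> \<turnstile> n \<Ztypecolon> NatT \<Longrightarrow>
    \<Gamma> \<turnstile> NatInd C c d n \<Ztypecolon> C\<langle>n \<cdot> Var\<rangle>"
| nat_comp0: "NatT # \<Gamma> \<turnstile> C \<Ztypecolon> Univ i \<Longrightarrow> \<Gamma> \<turnstile> c \<Ztypecolon> C\<langle>ZeroT \<cdot> Var\<rangle> \<Longrightarrow>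
    C # NatT # \<Gamma> \<turnstile> d \<Ztypecolon> C\<langle>SucT (Var 1) \<cdot> (\<lambda>k. Var (k + 2))\<rangle> \<Longrightarrow>
    \<Gamma> \<turnstile> NatInd C c d ZeroT \<doteq> c \<Ztypecolon> C\<langle>ZeroT \<cdot> Var\<rangle>"
| nat_compS: "NatT # \<Gamma> \<turnstile> C \<Ztypecolon> Univ i \<Longrightarrow> \<Gamma> \<turnstile> c \<Ztypecolon> C\<langle>ZeroT \<cdot> Var\<rangle> \<Longrightarrow>
    C # NatT # \<Gamma> \<turnstile> d \<Ztypecolon> C\<langle>SucT (Var 1) \<cdot> (\<lambda>k. Var (k + 2))\<rangle> \<Longrightarrow>
    \<Gamma> \<turnstile> n \<Ztypecolon> NatT \<Longrightarrow>
    \<Gamma> \<turnstile> NatInd C c d (SucT n) \<doteq> d\<langle>NatInd C c d n \<cdot> n \<cdot> Var\<rangle> \<Ztypecolon> C\<langle>SucT n \<cdot> Var\<rangle>"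
| nat_introS_cong: "\<Gamma> \<turnstile> n \<doteq> n' \<Ztypecolon> NatT \<Longrightarrow> \<Gamma> \<turnstile> SucT n \<doteq> SucT n' \<Ztypecolon> NatT"
| nat_elim_cong: "NatT # \<Gamma> \<turnstile> C \<Ztypecolon> Univ i \<Longrightarrow> NatT # \<Gamma> \<turnstile> C \<doteq> C' \<Ztypecolon> Univ i \<Longrightarrow>
    \<Gamma> \<turnstile> c \<doteq> c' \<Ztypecolon> C\<langle>ZeroT \<cdot> Var\<rangle> \<Longrightarrow>
    C # NatT # \<Gamma> \<turnstile> d \<doteq> d' \<Ztypecolon> C\<langle>SucT (Var 1) \<cdot> (\<lambda>k. Var (k + 2))\<rangle> \<Longrightarrow>
    \<Gamma> \<turnstile> n \<doteq> n' \<Ztypecolon> NatT \<Longrightarrow>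
    \<Gamma> \<turnstile> NatInd C c d n \<doteq> NatInd C' c' d' n' \<Ztypecolon> C\<langle>n \<cdot> Var\<rangle>"

| id_form: "\<Gamma> \<turnstile> A \<Ztypecolon> Univ i \<Longrightarrow> \<Gamma> \<turnstile> a \<Ztypecolon> A \<Longrightarrow> \<Gamma> \<turnstile> b \<Ztypecolon> A \<Longrightarrow> \<Gamma> \<turnstile> IdT A a b \<Ztypecolon> Univ i"
| id_intro: "\<Gamma> \<turnstile> A \<Ztypecolon> Univ i \<Longrightarrow> \<Gamma> \<turnstile> a \<Ztypecolon> A \<Longrightarrow> \<Gamma> \<turnstile> Refl a \<Ztypecolon> IdT A a a"
| id_elim: "IdT (wk (wk A)) (Var 1) (Var 0) # wk A # A # \<Gamma> \<turnstile> C \<Ztypecolon> Univ i \<Longrightarrow>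
    A # \<Gamma> \<turnstile> c \<Ztypecolon> C\<langle>Refl (Var 0) \<cdot> Var 0 \<cdot> Var 0 \<cdot> (\<lambda>k. Var (k + 1))\<rangle> \<Longrightarrow>
    \<Gamma> \<turnstile> a \<Ztypecolon> A \<Longrightarrow> \<Gamma> \<turnstile> b \<Ztypecolon> A \<Longrightarrow> \<Gamma> \<turnstile> p \<Ztypecolon> IdT A a b \<Longrightarrow>
    \<Gamma> \<turnstile> IdInd C c a b p \<Ztypecolon> C\<langle>p \<cdot> b \<cdot> a \<cdot> Var\<rangle>"
| id_comp: "IdT (wk (wk A)) (Var 1) (Var 0) # wk A # A # \<Gamma> \<turnstile> C \<Ztypecolon> Univ i \<Longrightarrow>
    A # \<Gamma> \<turnstile> c \<Ztypecolon> C\<langle>Refl (Var 0) \<cdot> Var 0 \<cdot> Var 0 \<cdot> (\<lambda>k. Var (k + 1))\<rangle> \<Longrightarrow>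
    \<Gamma> \<turnstile> a \<Ztypecolon> A \<Longrightarrow>
    \<Gamma> \<turnstile> IdInd C c a a (Refl a) \<doteq> c\<langle>a \<cdot> Var\<rangle> \<Ztypecolon> C\<langle>Refl a \<cdot> a \<cdot> a \<cdot> Var\<rangle>"
| id_form_cong: "\<Gamma> \<turnstile> A \<doteq> A' \<Ztypecolon> Univ i \<Longrightarrow> \<Gamma> \<turnstile> a \<doteq> a' \<Ztypecolon> A \<Longrightarrow> \<Gamma> \<turnstile> b \<doteq> b' \<Ztypecolon> A \<Longrightarrow>
    \<Gamma> \<turnstile> IdT A a b \<doteq> IdT A' a' b' \<Ztypecolon> Univ i"
| id_intro_cong: "\<Gamma> \<turnstile> A \<Ztypecolon> Univ i \<Longrightarrow> \<Gamma> \<turnstile> a \<doteq> a' \<Ztypecolon> A \<Longrightarrow> \<Gamma> \<turnstile> Refl a \<doteq> Refl a' \<Ztypecolon> IdT A a a"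
| id_elim_cong: "IdT (wk (wk A)) (Var 1) (Var 0) # wk A # A # \<Gamma> \<turnstile> C \<doteq> C' \<Ztypecolon> Univ i \<Longrightarrow>
    A # \<Gamma> \<turnstile> c \<doteq> c' \<Ztypecolon> C\<langle>Refl (Var 0) \<cdot> Var 0 \<cdot> Var 0 \<cdot> (\<lambda>k. Var (k + 1))\<rangle> \<Longrightarrow>
    \<Gamma> \<turnstile> a \<doteq> a' \<Ztypecolon> A \<Longrightarrow> \<Gamma> \<turnstile> b \<doteq> b' \<Ztypecolon> A \<Longrightarrow> \<Gamma> \<turnstile> p \<doteq> p' \<Ztypecolon> IdT A a b \<Longrightarrow>
    \<Gamma> \<turnstile> IdInd C c a b p \<doteq> IdInd C' c' a' b' p' \<Ztypecolon> C\<langle>p \<cdot> b \<cdot> a \<cdot> Var\<rangle>"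

end

theory Submission
  imports Defs
begin

text \<open>
  The splitting is \<open>A = (\<Sum>x : X. f x = x)\<close> with \<open>r x = (f x, I x)\<close> and \<open>s\<close> the first projection, so
  that \<open>s (r x)\<close> computes to \<open>f x\<close>. For \<open>r (s a) = a\<close> it suffices that any two elements of \<open>A\<close> are
  equal (Kraus, Escardo, Coquand, Altenkirch). Given \<open>(x, p\<^sub>0) : A\<close>, weak constancy yields a family
  \<open>c u : f u = x\<close>, namely \<open>W u x \<bullet> p\<^sub>0\<close>. Every \<open>(y, p) : A\<close> equals \<open>(x, c x)\<close>: if \<open>s : y = x\<close> is the
  path with \<open>p \<bullet> s = c y\<close>, path induction on \<open>s\<close> reduces this to \<open>p = c y\<close>. So \<open>(y, p)\<close> and
  \<open>(x, p\<^sub>0)\<close> are both equal to \<open>(x, c x)\<close>.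

  All paths are obtained by path induction as mere inhabitation statements; only path composition,
  which occurs in types, is a named term. Of the metatheory, only weakening is needed.
\<close>

section \<open>Renaming and substitution\<close>

lemma scons_simps [simp]:
  "(a \<cdot> \<sigma>) 0 = a" "(a \<cdot> \<sigma>) (Suc n) = \<sigma> n"
  by (simp_all add: scons_def)

lemma upr_simps [simp]: "upr \<rho> 0 = 0" "upr \<rho> (Suc n) = Suc (\<rho> n)"
  by (simp_all add: upr_def)

text \<open>The literal index \<open>1\<close> does not match \<open>Suc n\<close> under
  \<open>simp only\<close>, and it occurs below two binders in several rules, such as the motive of
  \<open>id_elim\<close> and the branch of \<open>sigma_elim\<close>.\<close>

lemma upr_upr_1: "upr (upr \<rho>) 1 = 1"
  by simp

lemma ups_simps [simp]: "ups \<sigma> 0 = Var 0" "ups \<sigma> (Suc n) = wk (\<sigma> n)"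
  by (simp_all add: ups_def)

lemma nat_fun_eqI: "f 0 = g 0 \<Longrightarrow> (\<And>n. f (Suc n) = g (Suc n)) \<Longrightarrow> f = g"
  for f g :: "nat \<Rightarrow> 'a"
  by (rule ext) (metis not0_implies_Suc)

lemma ups_Var_comp: "ups (\<lambda>n. Var (\<rho> n)) = (\<lambda>n. Var (upr \<rho> n))"
  by (rule nat_fun_eqI) simp_all

lemma ren_eq_subst: "ren t \<rho> = t\<langle>\<lambda>n. Var (\<rho> n)\<rangle>"
  by (induction t arbitrary: \<rho>) (simp_all add: ups_Var_comp)

lemma ups_Var: "ups Var = Var"
  by (rule nat_fun_eqI) simp_all

lemma subst_Var: "t\<langle>Var\<rangle> = t"
  by (induction t) (simp_all add: ups_Var)

lemma ups_upr: "(\<lambda>n. ups \<sigma> (upr \<rho> n)) = ups (\<lambda>n. \<sigma> (\<rho> n))"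
  by (rule nat_fun_eqI) simp_all

lemma subst_ren: "(ren t \<rho>)\<langle>\<sigma>\<rangle> = t\<langle>\<lambda>n. \<sigma> (\<rho> n)\<rangle>"
  by (induction t arbitrary: \<sigma> \<rho>) (simp_all add: ups_upr)

lemma upr_upr: "(\<lambda>n. upr \<rho>' (upr \<rho> n)) = upr (\<lambda>n. \<rho>' (\<rho> n))"
  by (rule nat_fun_eqI) simp_all

lemma ren_ren: "ren (ren t \<rho>) \<rho>' = ren t (\<lambda>n. \<rho>' (\<rho> n))"
  by (induction t arbitrary: \<rho> \<rho>') (simp_all add: upr_upr)

lemma ren_ups: "(\<lambda>n. ren (ups \<sigma> n) (upr \<rho>)) = ups (\<lambda>n. ren (\<sigma> n) \<rho>)"
  by (rule nat_fun_eqI) (simp_all add: ren_ren)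

lemma ren_subst: "ren (t\<langle>\<sigma>\<rangle>) \<rho> = t\<langle>\<lambda>n. ren (\<sigma> n) \<rho>\<rangle>"
  by (induction t arbitrary: \<sigma> \<rho>) (simp_all add: ren_ups)

text \<open>Lifting weakens the values of \<sigma>, so composing two lifted substitutions needs both
  mixed laws, \<open>subst_ren\<close> and \<open>ren_subst\<close>. The latter rests on
  \<open>ren_ren\<close> for the same reason.\<close>

lemma ups_subst: "(\<lambda>n. (ups \<sigma> n)\<langle>ups \<tau>\<rangle>) = ups (\<lambda>n. (\<sigma> n)\<langle>\<tau>\<rangle>)"
  by (rule nat_fun_eqI) (simp_all add: subst_ren ren_subst)

lemma subst_subst: "(t\<langle>\<sigma>\<rangle>)\<langle>\<tau>\<rangle> = t\<langle>\<lambda>n. (\<sigma> n)\<langle>\<tau>\<rangle>\<rangle>"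
  by (induction t arbitrary: \<sigma> \<tau>) (simp_all add: ups_subst)

section \<open>Weakening\<close>

lemma ren_wk: "ren (wk t) (upr \<rho>) = wk (ren t \<rho>)"
  by (simp add: ren_ren)

lemma scons_comp_ren: "(\<lambda>n. ren ((a \<cdot> \<sigma>) n) \<rho>) = ren a \<rho> \<cdot> (\<lambda>n. ren (\<sigma> n) \<rho>)"
  by (rule nat_fun_eqI) simp_all

lemma scons_upr: "(\<lambda>n. (a \<cdot> \<sigma>) (upr \<rho> n)) = a \<cdot> (\<lambda>n. \<sigma> (\<rho> n))"
  by (rule nat_fun_eqI) simp_all

text \<open>One equation for each shape of instantiation in the typing rules. They bring a renamed
  premise or conclusion back into the literal form of the rule, so that the rule can be applied
  again.\<close>

lemma ren_instances:
  "ren (B\<langle>a \<cdot> Var\<rangle>) \<rho> = (ren B (upr \<rho>))\<langle>ren a \<rho> \<cdot> Var\<rangle>"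
  "ren (B\<langle>b \<cdot> a \<cdot> Var\<rangle>) \<rho> = (ren B (upr (upr \<rho>)))\<langle>ren b \<rho> \<cdot> ren a \<rho> \<cdot> Var\<rangle>"
  "ren (B\<langle>p \<cdot> b \<cdot> a \<cdot> Var\<rangle>) \<rho> =
    (ren B (upr (upr (upr \<rho>))))\<langle>ren p \<rho> \<cdot> ren b \<rho> \<cdot> ren a \<rho> \<cdot> Var\<rangle>"
  "ren (B\<langle>a \<cdot> (\<lambda>k. Var (k + 1))\<rangle>) (upr \<rho>) =
    (ren B (upr \<rho>))\<langle>ren a (upr \<rho>) \<cdot> (\<lambda>k. Var (k + 1))\<rangle>"
  "ren (B\<langle>p \<cdot> b \<cdot> a \<cdot> (\<lambda>k. Var (k + 1))\<rangle>) (upr \<rho>) =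
    (ren B (upr (upr (upr \<rho>))))\<langle>ren p (upr \<rho>) \<cdot> ren b (upr \<rho>) \<cdot> ren a (upr \<rho>) \<cdot> (\<lambda>k. Var (k + 1))\<rangle>"
  "ren (B\<langle>a \<cdot> (\<lambda>k. Var (k + 2))\<rangle>) (upr (upr \<rho>)) =
    (ren B (upr \<rho>))\<langle>ren a (upr (upr \<rho>)) \<cdot> (\<lambda>k. Var (k + 2))\<rangle>"
  by (simp_all add: ren_subst subst_ren scons_comp_ren scons_upr)

text \<open>Purely syntactic: well-formedness of the target context is tracked separately.\<close>

definition renames :: "(nat \<Rightarrow> nat) \<Rightarrow> tm list \<Rightarrow> tm list \<Rightarrow> bool" where
  "renames \<rho> \<Gamma> \<Delta> \<longleftrightarrow> (\<forall>n < length \<Gamma>. \<rho> n < length \<Delta> \<and>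
     ren (\<Delta> ! \<rho> n) (\<lambda>k. k + Suc (\<rho> n)) = ren (ren (\<Gamma> ! n) (\<lambda>k. k + Suc n)) \<rho>)"

lemma renames_upr:
  assumes "renames \<rho> \<Gamma> \<Delta>"
  shows "renames (upr \<rho>) (A # \<Gamma>) (ren A \<rho> # \<Delta>)"
  unfolding renames_def
proof (intro allI impI)
  fix n assume n: "n < length (A # \<Gamma>)"
  show "upr \<rho> n < length (ren A \<rho> # \<Delta>) \<and>
     ren ((ren A \<rho> # \<Delta>) ! upr \<rho> n) (\<lambda>k. k + Suc (upr \<rho> n)) =
     ren (ren ((A # \<Gamma>) ! n) (\<lambda>k. k + Suc n)) (upr \<rho>)"
  proof (cases n)
    case 0
    then show ?thesis by (simp add: ren_ren)
  next
    case (Suc m)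
    have *: "\<rho> m < length \<Delta>"
      "ren (\<Delta> ! \<rho> m) (\<lambda>k. k + Suc (\<rho> m)) = ren (ren (\<Gamma> ! m) (\<lambda>k. k + Suc m)) \<rho>"
      using assms n Suc by (simp_all add: renames_def)
    show ?thesis
      \<comment> \<open>Past the new variable, both sides are the equation for \<open>m\<close>
        weakened once more.\<close>
      using *(1) arg_cong[OF *(2), of wk] Suc by (simp add: ren_ren)
  qed
qed

text \<open>Several rules have a premise in a context \<open>A # \<Gamma>\<close> without a premise typing \<open>A\<close>. Carrying
  this predicate through the induction makes the renamed extended context available there.\<close>

fun renamable_ctx :: "tm list \<Rightarrow> bool" where
  "renamable_ctx [] \<longleftrightarrow> True"
| "renamable_ctx (A # \<Gamma>) \<longleftrightarrow> renamable_ctx \<Gamma> \<and>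
    (\<forall>\<Delta> \<rho>. is_ctx \<Delta> \<longrightarrow> renames \<rho> \<Gamma> \<Delta> \<longrightarrow> is_ctx (ren A \<rho> # \<Delta>))"

definition renamable :: "tm list \<Rightarrow> tm \<Rightarrow> tm \<Rightarrow> bool" where
  "renamable \<Gamma> t A \<longleftrightarrow> renamable_ctx \<Gamma> \<and>
    (\<forall>\<Delta> \<rho>. is_ctx \<Delta> \<longrightarrow> renames \<rho> \<Gamma> \<Delta> \<longrightarrow> \<Delta> \<turnstile> ren t \<rho> \<Ztypecolon> ren A \<rho>)"

definition renamable_eq :: "tm list \<Rightarrow> tm \<Rightarrow> tm \<Rightarrow> tm \<Rightarrow> bool" where
  "renamable_eq \<Gamma> t u A \<longleftrightarrow> renamable_ctx \<Gamma> \<and>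
    (\<forall>\<Delta> \<rho>. is_ctx \<Delta> \<longrightarrow> renames \<rho> \<Gamma> \<Delta> \<longrightarrow> \<Delta> \<turnstile> ren t \<rho> \<doteq> ren u \<rho> \<Ztypecolon> ren A \<rho>)"

lemma renamable_ctxD:
  "renamable \<Gamma> t A \<Longrightarrow> renamable_ctx \<Gamma>" "renamable_eq \<Gamma> t u A \<Longrightarrow> renamable_ctx \<Gamma>"
  by (simp_all add: renamable_def renamable_eq_def)

text \<open>Renaming below zero to three new variables; three occur in the motive of
  \<open>IdInd\<close>. The extended target contexts are well-formed by
  \<open>renamable_ctx\<close>. Stating the context as an equation \<open>\<Psi> = ...\<close> lets
  each clause be turned into a destruction rule by \<open>refl\<close>.\<close>

lemma renamableD:
  assumes "renamable \<Psi> t T" "is_ctx \<Delta>" "renames \<rho> \<Gamma> \<Delta>"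
  shows "\<Psi> = \<Gamma> \<Longrightarrow> \<Delta> \<turnstile> ren t \<rho> \<Ztypecolon> ren T \<rho>"
    and "\<Psi> = A # \<Gamma> \<Longrightarrow> ren A \<rho> # \<Delta> \<turnstile> ren t (upr \<rho>) \<Ztypecolon> ren T (upr \<rho>)"
    and "\<Psi> = B # A # \<Gamma> \<Longrightarrow> ren B (upr \<rho>) # ren A \<rho> # \<Delta> \<turnstile>
          ren t (upr (upr \<rho>)) \<Ztypecolon> ren T (upr (upr \<rho>))"
    and "\<Psi> = C # B # A # \<Gamma> \<Longrightarrow> ren C (upr (upr \<rho>)) # ren B (upr \<rho>) # ren A \<rho> # \<Delta> \<turnstile>
          ren t (upr (upr (upr \<rho>))) \<Ztypecolon> ren T (upr (upr (upr \<rho>)))"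
  using assms by (simp_all add: renamable_def renames_upr)

lemma renamable_eqD:
  assumes "renamable_eq \<Psi> t u T" "is_ctx \<Delta>" "renames \<rho> \<Gamma> \<Delta>"
  shows "\<Psi> = \<Gamma> \<Longrightarrow> \<Delta> \<turnstile> ren t \<rho> \<doteq> ren u \<rho> \<Ztypecolon> ren T \<rho>"
    and "\<Psi> = A # \<Gamma> \<Longrightarrow> ren A \<rho> # \<Delta> \<turnstile> ren t (upr \<rho>) \<doteq> ren u (upr \<rho>) \<Ztypecolon> ren T (upr \<rho>)"
    and "\<Psi> = B # A # \<Gamma> \<Longrightarrow> ren B (upr \<rho>) # ren A \<rho> # \<Delta> \<turnstile>
          ren t (upr (upr \<rho>)) \<doteq> ren u (upr (upr \<rho>)) \<Ztypecolon> ren T (upr (upr \<rho>))"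
    and "\<Psi> = C # B # A # \<Gamma> \<Longrightarrow> ren C (upr (upr \<rho>)) # ren B (upr \<rho>) # ren A \<rho> # \<Delta> \<turnstile>
          ren t (upr (upr (upr \<rho>))) \<doteq> ren u (upr (upr (upr \<rho>))) \<Ztypecolon> ren T (upr (upr (upr \<rho>)))"
  using assms by (simp_all add: renamable_eq_def renames_upr)

lemmas renamable_dests =
  renamableD(1)[OF _ _ _ refl] renamableD(2)[OF _ _ _ refl]
  renamableD(3)[OF _ _ _ refl] renamableD(4)[OF _ _ _ refl]
  renamable_eqD(1)[OF _ _ _ refl] renamable_eqD(2)[OF _ _ _ refl]
  renamable_eqD(3)[OF _ _ _ refl] renamable_eqD(4)[OF _ _ _ refl]

lemma renamableI:
  "renamable_ctx \<Gamma> \<Longrightarrow> (\<And>\<Delta> \<rho>. is_ctx \<Delta> \<Longrightarrow> renames \<rho> \<Gamma> \<Delta> \<Longrightarrow> \<Delta> \<turnstile> ren t \<rho> \<Ztypecolon> ren A \<rho>)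
    \<Longrightarrow> renamable \<Gamma> t A"
  "renamable_ctx \<Gamma> \<Longrightarrow> (\<And>\<Delta> \<rho>. is_ctx \<Delta> \<Longrightarrow> renames \<rho> \<Gamma> \<Delta> \<Longrightarrow> \<Delta> \<turnstile> ren t \<rho> \<doteq> ren u \<rho> \<Ztypecolon> ren A \<rho>)
    \<Longrightarrow> renamable_eq \<Gamma> t u A"
  by (simp_all add: renamable_def renamable_eq_def)

text \<open>Simultaneous induction over the three judgements: the induction hypotheses at the
  suitably lifted renaming give the renamed premises, and the same rule derives the renamed
  conclusion.\<close>

lemma renamable_all:
  "is_ctx \<Gamma> \<Longrightarrow> renamable_ctx \<Gamma>"
  "\<Gamma> \<turnstile> t \<Ztypecolon> T \<Longrightarrow> renamable \<Gamma> t T"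
  "\<Gamma> \<turnstile> t \<doteq> u \<Ztypecolon> T \<Longrightarrow> renamable_eq \<Gamma> t u T"
proof (induction rule: is_ctx_has_type_jeq.inducts)
  case (ctx_ext \<Gamma> A i)
  then show ?case
    by (fastforce simp: renamable_def intro: is_ctx_has_type_jeq.ctx_ext)
next
  case (var \<Gamma> n)
  show ?case
  proof (rule renamableI)
    show "renamable_ctx \<Gamma>" using var by blast
  next
    fix \<Delta> \<rho> assume "is_ctx \<Delta>" "renames \<rho> \<Gamma> \<Delta>"
    with var show "\<Delta> \<turnstile> ren (Var n) \<rho> \<Ztypecolon> ren (ren (\<Gamma> ! n) (\<lambda>k. k + Suc n)) \<rho>"
      using is_ctx_has_type_jeq.var[of \<Delta> "\<rho> n"] unfolding renames_def by simp
  qed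
\<comment> \<open>\<open>simp\<close> settles the empty context. Every other rule is replayed
  uniformly: rename all premises, move the renaming through the instantiations, and apply the rule
  again.\<close>
qed (simp, (rule renamableI,
    (assumption | erule renamable_ctxD),
    ((drule (2) renamable_dests)+)?,
    (simp (no_asm_use) only: ren.simps ren_instances ren_wk upr_simps(1) upr_upr_1)?,
    (rule is_ctx_has_type_jeq.intros; assumption))+)

text \<open>Shifting past \<open>\<Xi>\<close> is a renaming from \<open>\<Gamma>\<close> to
  \<open>\<Xi> @ \<Gamma>\<close>. The result is phrased with substitutions because all later
  calculations are carried out on them.\<close>

lemma weaken:
  assumes "\<Gamma> \<turnstile> t \<Ztypecolon> T" "is_ctx (\<Xi> @ \<Gamma>)"
  shows "\<Xi> @ \<Gamma> \<turnstile> t\<langle>\<lambda>k. Var (k + length \<Xi>)\<rangle> \<Ztypecolon> T\<langle>\<lambda>k. Var (k + length \<Xi>)\<rangle>"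
proof -
  have "renames (\<lambda>k. k + length \<Xi>) \<Gamma> (\<Xi> @ \<Gamma>)"
    by (auto simp: renames_def nth_append ren_ren add_ac)
  then show ?thesis
    using renamableD(1)[OF renamable_all(2)[OF assms(1)] assms(2) _ refl]
    by (simp add: ren_eq_subst)
qed

lemmas weaken1 = weaken[where \<Xi> = "[A]" for A, simplified]
lemmas weaken2 = weaken[where \<Xi> = "[B, A]" for A B, simplified]
lemmas weaken3 = weaken[where \<Xi> = "[C, B, A]" for A B C, simplified]
lemmas weaken4 = weaken[where \<Xi> = "[D, C, B, A]" for A B C D, simplified]

section \<open>Normal forms of substituted terms\<close>

text \<open>The type is tied to the context by an equation, so the rule applies to any way of
  writing the weakened type and leaves the comparison to \<open>simp\<close>.\<close>

lemma var_typing: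
  assumes "is_ctx \<Gamma>" "n < length \<Gamma>" "T = (\<Gamma> ! n)\<langle>\<lambda>k. Var (k + Suc n)\<rangle>"
  shows "\<Gamma> \<turnstile> Var n \<Ztypecolon> T"
  using var[OF assms(1,2)] assms(3) by (simp add: ren_eq_subst)

lemma ups_eq: "ups \<sigma> = Var 0 \<cdot> (\<lambda>n. (\<sigma> n)\<langle>\<lambda>k. Var (Suc k)\<rangle>)"
  by (simp add: ups_def ren_eq_subst)

lemma scons_comp_subst: "(\<lambda>n. ((a \<cdot> \<sigma>) n)\<langle>\<tau>\<rangle>) = a\<langle>\<tau>\<rangle> \<cdot> (\<lambda>n. (\<sigma> n)\<langle>\<tau>\<rangle>)"
  by (rule nat_fun_eqI) simp_all

lemma scons_Var: "Var 0 \<cdot> (\<lambda>n. Var (Suc n)) = Var"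
  by (rule nat_fun_eqI) simp_all

text \<open>As rewrite rules these turn weakenings into substitutions, fuse nested substitutions and
  write numeral indices as successors. Two presentations of the same substituted type then become
  syntactically equal. \<open>ren.simps\<close> is withdrawn from the simplifier because
  \<open>ren\<close> itself is rewritten away.\<close>

lemmas subst_normalise =
  ren_eq_subst subst_subst subst_Var ups_eq scons_comp_subst scons_Var numeral_eq_Suc

declare ren.simps [simp del] subst_normalise [simp]

section \<open>Path composition\<close>

lemma path_ctx:
  assumes "\<Gamma> \<turnstile> A \<Ztypecolon> Univ i"
  shows "is_ctx (A # \<Gamma>)" "is_ctx (wk A # A # \<Gamma>)"
    "is_ctx (IdT (wk (wk A)) (Var 1) (Var 0) # wk A # A # \<Gamma>)"
proof -
  show 1: "is_ctx (A # \<Gamma>)" using assms by (rule ctx_ext)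
  show 2: "is_ctx (wk A # A # \<Gamma>)"
    using weaken1[OF assms 1] by (intro ctx_ext) simp
  have "wk A # A # \<Gamma> \<turnstile> IdT (wk (wk A)) (Var 1) (Var 0) \<Ztypecolon> Univ i"
    using weaken2[OF assms 2]
    by (intro id_form var_typing 2) simp_all
  then show "is_ctx (IdT (wk (wk A)) (Var 1) (Var 0) # wk A # A # \<Gamma>)"
    by (rule ctx_ext)
qed

text \<open>The composite \<open>p\<close> followed by \<open>q\<close>, by path induction on
  \<open>q\<close> with motive \<open>(a = x) -> (a = y)\<close> and the identity function as
  branch. The two occurrences of \<open>Var 2\<close> differ: the first is \<open>x\<close>, the
  second, below one more binder, is \<open>y\<close>.\<close>

definition path_comp :: "tm \<Rightarrow> tm \<Rightarrow> tm \<Rightarrow> tm \<Rightarrow> tm \<Rightarrow> tm \<Rightarrow> tm" where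
  "path_comp A a b d p q =
    App (IdInd (Pi (IdT (wk (wk (wk A))) (wk (wk (wk a))) (Var 2))
                   (IdT (wk (wk (wk (wk A)))) (wk (wk (wk (wk a)))) (Var 2)))
               (Lam (IdT (wk A) (wk a) (Var 0)) (Var 0)) b d q) p"

text \<open>With such a rule, normalisation passes through a defined term without unfolding it. The
  later definitions of terms and types get analogous rules.\<close>

lemma subst_path_comp [simp]:
  "(path_comp A a b d p q)\<langle>\<sigma>\<rangle> = path_comp (A\<langle>\<sigma>\<rangle>) (a\<langle>\<sigma>\<rangle>) (b\<langle>\<sigma>\<rangle>) (d\<langle>\<sigma>\<rangle>) (p\<langle>\<sigma>\<rangle>) (q\<langle>\<sigma>\<rangle>)"
  by (simp add: path_comp_def)

lemma path_comp_motive: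
  assumes A: "\<Gamma> \<turnstile> A \<Ztypecolon> Univ i" and a: "\<Gamma> \<turnstile> a \<Ztypecolon> A"
  shows "IdT (wk (wk A)) (Var 1) (Var 0) # wk A # A # \<Gamma> \<turnstile>
    Pi (IdT (wk (wk (wk A))) (wk (wk (wk a))) (Var 2))
       (IdT (wk (wk (wk (wk A)))) (wk (wk (wk (wk a)))) (Var 2)) \<Ztypecolon> Univ i"
    (is "?\<Delta> \<turnstile> Pi ?P ?Q \<Ztypecolon> _")
proof (rule pi_form)
  note ctx = path_ctx(3)[OF A]
  show P: "?\<Delta> \<turnstile> ?P \<Ztypecolon> Univ i"
    using weaken3[OF A ctx] weaken3[OF a ctx]
    by (intro id_form var_typing ctx) simp_all
  note ctx' = ctx_ext[OF P]
  show "?P # ?\<Delta> \<turnstile> ?Q \<Ztypecolon> Univ i"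
    using weaken4[OF A ctx'] weaken4[OF a ctx']
    by (intro id_form var_typing ctx') simp_all
qed

lemma path_comp_branch:
  assumes A: "\<Gamma> \<turnstile> A \<Ztypecolon> Univ i" and a: "\<Gamma> \<turnstile> a \<Ztypecolon> A"
  shows "A # \<Gamma> \<turnstile> IdT (wk A) (wk a) (Var 0) \<Ztypecolon> Univ i"
    and "A # \<Gamma> \<turnstile> Lam (IdT (wk A) (wk a) (Var 0)) (Var 0) \<Ztypecolon>
      Pi (IdT (wk A) (wk a) (Var 0)) (IdT (wk (wk A)) (wk (wk a)) (Var 1))"
proof -
  note ctx = path_ctx(1)[OF A]
  show P: "A # \<Gamma> \<turnstile> IdT (wk A) (wk a) (Var 0) \<Ztypecolon> Univ i"
    using weaken1[OF A ctx] weaken1[OF a ctx]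
    by (intro id_form var_typing ctx) simp_all
  show "A # \<Gamma> \<turnstile> Lam (IdT (wk A) (wk a) (Var 0)) (Var 0) \<Ztypecolon>
      Pi (IdT (wk A) (wk a) (Var 0)) (IdT (wk (wk A)) (wk (wk a)) (Var 1))"
    by (intro pi_intro[OF P] var_typing ctx_ext[OF P]) simp_all
qed

lemma path_comp_typing:
  assumes A: "\<Gamma> \<turnstile> A \<Ztypecolon> Univ i" and a: "\<Gamma> \<turnstile> a \<Ztypecolon> A" and b: "\<Gamma> \<turnstile> b \<Ztypecolon> A" and d: "\<Gamma> \<turnstile> d \<Ztypecolon> A"
    and p: "\<Gamma> \<turnstile> p \<Ztypecolon> IdT A a b" and q: "\<Gamma> \<turnstile> q \<Ztypecolon> IdT A b d"
  shows "\<Gamma> \<turnstile> path_comp A a b d p q \<Ztypecolon> IdT A a d"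
proof -
  have "\<Gamma> \<turnstile> IdInd (Pi (IdT (wk (wk (wk A))) (wk (wk (wk a))) (Var 2))
                   (IdT (wk (wk (wk (wk A)))) (wk (wk (wk (wk a)))) (Var 2)))
               (Lam (IdT (wk A) (wk a) (Var 0)) (Var 0)) b d q \<Ztypecolon> Pi (IdT A a b) (wk (IdT A a d))"
    using id_elim[OF path_comp_motive[OF A a] _ b d q] path_comp_branch[OF A a]
    by simp
  from pi_elim[OF this p] show ?thesis
    by (simp add: path_comp_def)
qed

text \<open>The right unit law is judgemental: path induction computes to the identity function at
  \<open>Refl b\<close>, and a beta step returns \<open>p\<close>. On the left there is no such
  reduction.\<close>

lemma path_comp_Refl:
  assumes A: "\<Gamma> \<turnstile> A \<Ztypecolon> Univ i" and a: "\<Gamma> \<turnstile> a \<Ztypecolon> A" and b: "\<Gamma> \<turnstile> b \<Ztypecolon> A"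
    and p: "\<Gamma> \<turnstile> p \<Ztypecolon> IdT A a b"
  shows "\<Gamma> \<turnstile> path_comp A a b b p (Refl b) \<doteq> p \<Ztypecolon> IdT A a b"
proof -
  have P: "\<Gamma> \<turnstile> IdT A a b \<Ztypecolon> Univ i" using A a b by (rule id_form)
  have "\<Gamma> \<turnstile> IdInd (Pi (IdT (wk (wk (wk A))) (wk (wk (wk a))) (Var 2))
                   (IdT (wk (wk (wk (wk A)))) (wk (wk (wk (wk a)))) (Var 2)))
               (Lam (IdT (wk A) (wk a) (Var 0)) (Var 0)) b b (Refl b)
      \<doteq> Lam (IdT A a b) (Var 0) \<Ztypecolon> Pi (IdT A a b) (wk (IdT A a b))"
    using id_comp[OF path_comp_motive[OF A a] _ b, of "Lam (IdT (wk A) (wk a) (Var 0)) (Var 0)"] path_comp_branch[OF A a]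
    by simp
  from pi_elim_cong[OF this eq_refl[OF p]]
  have "\<Gamma> \<turnstile> path_comp A a b b p (Refl b) \<doteq> App (Lam (IdT A a b) (Var 0)) p \<Ztypecolon> IdT A a b"
    by (simp add: path_comp_def)
  moreover have "IdT A a b # \<Gamma> \<turnstile> Var 0 \<Ztypecolon> wk (IdT A a b)"
    by (rule var_typing) (simp_all add: ctx_ext[OF P])
  from pi_comp[OF this p] have "\<Gamma> \<turnstile> App (Lam (IdT A a b) (Var 0)) p \<doteq> p \<Ztypecolon> IdT A a b"
    by simp
  ultimately show ?thesis by (rule eq_trans)
qed


section \<open>Inhabitation by path induction\<close>

text \<open>Existence of a term at the meta level, not a truncation inside the type theory, so a
  concrete element can always be obtained again.\<close>

definition inhabited :: "tm list \<Rightarrow> tm \<Rightarrow> bool" where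
  "inhabited \<Gamma> T \<longleftrightarrow> (\<exists>t. \<Gamma> \<turnstile> t \<Ztypecolon> T)"

lemma inhabitedI: "\<Gamma> \<turnstile> t \<Ztypecolon> T \<Longrightarrow> inhabited \<Gamma> T"
  by (auto simp: inhabited_def)

lemma inhabited_Pi: "\<Gamma> \<turnstile> A \<Ztypecolon> Univ i \<Longrightarrow> inhabited (A # \<Gamma>) B \<Longrightarrow> inhabited \<Gamma> (Pi A B)"
  by (auto simp: inhabited_def intro: pi_intro)

lemma inhabited_App: "inhabited \<Gamma> (Pi A B) \<Longrightarrow> \<Gamma> \<turnstile> a \<Ztypecolon> A \<Longrightarrow> inhabited \<Gamma> (B\<langle>a \<cdot> Var\<rangle>)"
  by (auto simp: inhabited_def intro: pi_elim)

lemma inhabited_path_induct: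
  assumes "IdT (wk (wk A)) (Var 1) (Var 0) # wk A # A # \<Gamma> \<turnstile> C \<Ztypecolon> Univ i"
    and "inhabited (A # \<Gamma>) (C\<langle>Refl (Var 0) \<cdot> Var 0 \<cdot> Var 0 \<cdot> (\<lambda>k. Var (k + 1))\<rangle>)"
    and "\<Gamma> \<turnstile> a \<Ztypecolon> A" "\<Gamma> \<turnstile> b \<Ztypecolon> A" "\<Gamma> \<turnstile> p \<Ztypecolon> IdT A a b"
  shows "inhabited \<Gamma> (C\<langle>p \<cdot> b \<cdot> a \<cdot> Var\<rangle>)"
  using assms id_elim unfolding inhabited_def by blast

text \<open>The ambient type, the two generic points and the generic path in the context of a path
  induction motive, with types already in the normal form of three weakenings.\<close>

lemma path_ctx_typing:
  assumes A: "\<Gamma> \<turnstile> A \<Ztypecolon> Univ i"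
  defines "\<Delta> \<equiv> IdT (wk (wk A)) (Var 1) (Var 0) # wk A # A # \<Gamma>"
  shows "\<Delta> \<turnstile> A\<langle>\<lambda>k. Var (Suc (Suc (Suc k)))\<rangle> \<Ztypecolon> Univ i"
    and "\<Delta> \<turnstile> Var 2 \<Ztypecolon> A\<langle>\<lambda>k. Var (Suc (Suc (Suc k)))\<rangle>"
    and "\<Delta> \<turnstile> Var 1 \<Ztypecolon> A\<langle>\<lambda>k. Var (Suc (Suc (Suc k)))\<rangle>"
    and "\<Delta> \<turnstile> Var 0 \<Ztypecolon> IdT (A\<langle>\<lambda>k. Var (Suc (Suc (Suc k)))\<rangle>) (Var 2) (Var 1)"
proof -
  note ctx = path_ctx(3)[OF A, folded \<Delta>_def]
  show "\<Delta> \<turnstile> A\<langle>\<lambda>k. Var (Suc (Suc (Suc k)))\<rangle> \<Ztypecolon> Univ i"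
    using weaken3[OF A] ctx by (simp add: \<Delta>_def)
  show "\<Delta> \<turnstile> Var 2 \<Ztypecolon> A\<langle>\<lambda>k. Var (Suc (Suc (Suc k)))\<rangle>"
    "\<Delta> \<turnstile> Var 1 \<Ztypecolon> A\<langle>\<lambda>k. Var (Suc (Suc (Suc k)))\<rangle>"
    "\<Delta> \<turnstile> Var 0 \<Ztypecolon> IdT (A\<langle>\<lambda>k. Var (Suc (Suc (Suc k)))\<rangle>) (Var 2) (Var 1)"
    by (rule var_typing[OF ctx]; simp add: \<Delta>_def)+
qed

lemma path_inverse:
  assumes A: "\<Gamma> \<turnstile> A \<Ztypecolon> Univ i" and ab: "\<Gamma> \<turnstile> a \<Ztypecolon> A" "\<Gamma> \<turnstile> b \<Ztypecolon> A" and p: "inhabited \<Gamma> (IdT A a b)"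
  shows "inhabited \<Gamma> (IdT A b a)"
proof -
  obtain t where t: "\<Gamma> \<turnstile> t \<Ztypecolon> IdT A a b" using p by (auto simp: inhabited_def)
  have C: "IdT (wk (wk A)) (Var 1) (Var 0) # wk A # A # \<Gamma> \<turnstile>
      IdT (A\<langle>\<lambda>k. Var (Suc (Suc (Suc k)))\<rangle>) (Var 1) (Var 2) \<Ztypecolon> Univ i"
    by (intro id_form path_ctx_typing[OF A])
  have "A # \<Gamma> \<turnstile> Refl (Var 0) \<Ztypecolon> IdT (wk A) (Var 0) (Var 0)"
    using weaken1[OF A path_ctx(1)[OF A]]
    by (intro id_intro var_typing path_ctx[OF A]) simp_all
  then show ?thesis
    using inhabited_path_induct[OF C _ ab t] by (simp add: inhabitedI)
qed

lemma path_cotrans: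
  assumes A: "\<Gamma> \<turnstile> A \<Ztypecolon> Univ i" and a: "\<Gamma> \<turnstile> a \<Ztypecolon> A" and b: "\<Gamma> \<turnstile> b \<Ztypecolon> A" and d: "\<Gamma> \<turnstile> d \<Ztypecolon> A"
    and p: "inhabited \<Gamma> (IdT A a d)" and q: "inhabited \<Gamma> (IdT A b d)"
  shows "inhabited \<Gamma> (IdT A a b)"
  using p path_inverse[OF A b d q] path_comp_typing[OF A a d b] by (auto simp: inhabited_def)

section \<open>Factoring one path through another\<close>

text \<open>The type of pairs of a path \<open>s : b = d\<close> and a proof that \<open>p\<close>
  followed by \<open>s\<close> equals \<open>t\<close>.\<close>

definition factorisation :: "tm \<Rightarrow> tm \<Rightarrow> tm \<Rightarrow> tm \<Rightarrow> tm \<Rightarrow> tm \<Rightarrow> tm" where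
  "factorisation A a b d p t = Sigma (IdT A b d)
    (IdT (IdT (wk A) (wk a) (wk d)) (path_comp (wk A) (wk a) (wk b) (wk d) (wk p) (Var 0)) (wk t))"

lemma subst_factorisation [simp]:
  "(factorisation A a b d p t)\<langle>\<sigma>\<rangle> =
    factorisation (A\<langle>\<sigma>\<rangle>) (a\<langle>\<sigma>\<rangle>) (b\<langle>\<sigma>\<rangle>) (d\<langle>\<sigma>\<rangle>) (p\<langle>\<sigma>\<rangle>) (t\<langle>\<sigma>\<rangle>)"
  by (simp add: factorisation_def)

lemma factorisation_form:
  assumes A: "\<Gamma> \<turnstile> A \<Ztypecolon> Univ i" and a: "\<Gamma> \<turnstile> a \<Ztypecolon> A" and b: "\<Gamma> \<turnstile> b \<Ztypecolon> A" and d: "\<Gamma> \<turnstile> d \<Ztypecolon> A"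
    and p: "\<Gamma> \<turnstile> p \<Ztypecolon> IdT A a b" and t: "\<Gamma> \<turnstile> t \<Ztypecolon> IdT A a d"
  shows "IdT A b d # \<Gamma> \<turnstile> IdT (IdT (wk A) (wk a) (wk d))
      (path_comp (wk A) (wk a) (wk b) (wk d) (wk p) (Var 0)) (wk t) \<Ztypecolon> Univ i"
    and "\<Gamma> \<turnstile> factorisation A a b d p t \<Ztypecolon> Univ i"
proof -
  have S: "\<Gamma> \<turnstile> IdT A b d \<Ztypecolon> Univ i" using A b d by (rule id_form)
  note ctx = ctx_ext[OF S]
  have "IdT A b d # \<Gamma> \<turnstile> Var 0 \<Ztypecolon> IdT (wk A) (wk b) (wk d)"
    by (rule var_typing[OF ctx]) simp_all
  then show E: "IdT A b d # \<Gamma> \<turnstile> IdT (IdT (wk A) (wk a) (wk d))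
      (path_comp (wk A) (wk a) (wk b) (wk d) (wk p) (Var 0)) (wk t) \<Ztypecolon> Univ i"
    using A[THEN weaken1, OF ctx] a[THEN weaken1, OF ctx] b[THEN weaken1, OF ctx]
      d[THEN weaken1, OF ctx] p[THEN weaken1, OF ctx] t[THEN weaken1, OF ctx]
    by (intro id_form path_comp_typing) simp_all
  show "\<Gamma> \<turnstile> factorisation A a b d p t \<Ztypecolon> Univ i"
    unfolding factorisation_def by (rule sigma_form[OF S E])
qed

text \<open>Composition does not reduce for \<open>Refl a\<close> on the left, so a path induction
  on \<open>t\<close> is needed. It makes all three paths reflexivities, and their composite does
  reduce.\<close>

lemma inhabited_factorisation_Refl:
  assumes A: "\<Gamma> \<turnstile> A \<Ztypecolon> Univ i" and a: "\<Gamma> \<turnstile> a \<Ztypecolon> A" and d: "\<Gamma> \<turnstile> d \<Ztypecolon> A" and t: "\<Gamma> \<turnstile> t \<Ztypecolon> IdT A a d"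
  shows "inhabited \<Gamma> (factorisation A a a d (Refl a) t)"
proof -
  \<comment> \<open>Stated for every context, since the induction branch lives over
    \<open>A # \<Gamma>\<close> with the new variable as the point.\<close>
  have base: "inhabited \<Delta> (factorisation B b b b (Refl b) (Refl b))"
    if B: "\<Delta> \<turnstile> B \<Ztypecolon> Univ i" and b: "\<Delta> \<turnstile> b \<Ztypecolon> B" for \<Delta> B b
  proof -
    have r: "\<Delta> \<turnstile> Refl b \<Ztypecolon> IdT B b b" using B b by (rule id_intro)
    have I: "\<Delta> \<turnstile> IdT B b b \<Ztypecolon> Univ i" using B b b by (rule id_form)
    have "\<Delta> \<turnstile> Refl (Refl b) \<Ztypecolon> IdT (IdT B b b) (Refl b) (Refl b)"
      using I r by (rule id_intro)
    moreover have "\<Delta> \<turnstile> IdT (IdT B b b) (Refl b) (Refl b) \<doteq>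
        IdT (IdT B b b) (path_comp B b b b (Refl b) (Refl b)) (Refl b) \<Ztypecolon> Univ i"
      by (intro id_form_cong eq_refl I r eq_sym[OF path_comp_Refl[OF B b b r]])
    ultimately have "\<Delta> \<turnstile> Refl (Refl b) \<Ztypecolon>
        IdT (IdT B b b) (path_comp B b b b (Refl b) (Refl b)) (Refl b)"
      by (rule conv)
    then have "\<Delta> \<turnstile> Pr (Refl b) (Refl (Refl b)) \<Ztypecolon> factorisation B b b b (Refl b) (Refl b)"
      unfolding factorisation_def
      by (intro sigma_intro[OF factorisation_form(1)[OF B b b b r r] r]) simp
    then show ?thesis by (rule inhabitedI)
  qed
  let ?A = "A\<langle>\<lambda>k. Var (Suc (Suc (Suc k)))\<rangle>"
  have C: "IdT (wk (wk A)) (Var 1) (Var 0) # wk A # A # \<Gamma> \<turnstile>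
      factorisation ?A (Var 2) (Var 2) (Var 1) (Refl (Var 2)) (Var 0) \<Ztypecolon> Univ i"
    by (intro factorisation_form(2)[where i = i] path_ctx_typing[OF A] id_intro[where i = i])
  have "inhabited (A # \<Gamma>)
      (factorisation (wk A) (Var 0) (Var 0) (Var 0) (Refl (Var 0)) (Refl (Var 0)))"
    using weaken1[OF A path_ctx(1)[OF A]]
    by (intro base var_typing path_ctx[OF A]) simp_all
  then show ?thesis
    using inhabited_path_induct[OF C _ a d t] by simp
qed

text \<open>Path induction on \<open>p\<close> reduces to the previous lemma.\<close>

lemma inhabited_factorisation:
  assumes A: "\<Gamma> \<turnstile> A \<Ztypecolon> Univ i" and a: "\<Gamma> \<turnstile> a \<Ztypecolon> A" and b: "\<Gamma> \<turnstile> b \<Ztypecolon> A" and d: "\<Gamma> \<turnstile> d \<Ztypecolon> A"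
    and p: "\<Gamma> \<turnstile> p \<Ztypecolon> IdT A a b" and t: "\<Gamma> \<turnstile> t \<Ztypecolon> IdT A a d"
  shows "inhabited \<Gamma> (factorisation A a b d p t)"
proof -
  \<comment> \<open>The type of \<open>t\<close> mentions the endpoint \<open>a\<close>, which
    varies in the induction on \<open>p\<close>; hence the motive quantifies over \<open>t\<close>,
    while \<open>d\<close> stays fixed.\<close>
  define P where "P A d a b p =
    Pi (IdT A a d) (factorisation (wk A) (wk a) (wk b) (wk d) (wk p) (Var 0))" for A d a b p
  have subst_P: "(P A d a b p)\<langle>\<sigma>\<rangle> = P (A\<langle>\<sigma>\<rangle>) (d\<langle>\<sigma>\<rangle>) (a\<langle>\<sigma>\<rangle>) (b\<langle>\<sigma>\<rangle>) (p\<langle>\<sigma>\<rangle>)" for A d a b p \<sigma>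
    by (simp add: P_def)
  have P_form: "\<Delta> \<turnstile> P A d a b p \<Ztypecolon> Univ i"
    if A: "\<Delta> \<turnstile> A \<Ztypecolon> Univ i" and a: "\<Delta> \<turnstile> a \<Ztypecolon> A" and b: "\<Delta> \<turnstile> b \<Ztypecolon> A" and d: "\<Delta> \<turnstile> d \<Ztypecolon> A"
      and p: "\<Delta> \<turnstile> p \<Ztypecolon> IdT A a b" for \<Delta> A d a b p
  proof -
    have T: "\<Delta> \<turnstile> IdT A a d \<Ztypecolon> Univ i" using A a d by (rule id_form)
    note ctx = ctx_ext[OF T]
    have "IdT A a d # \<Delta> \<turnstile> Var 0 \<Ztypecolon> IdT (wk A) (wk a) (wk d)"
      by (rule var_typing[OF ctx]) simp_all
    then show ?thesis
      using A[THEN weaken1, OF ctx] a[THEN weaken1, OF ctx] b[THEN weaken1, OF ctx]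
        d[THEN weaken1, OF ctx] p[THEN weaken1, OF ctx]
      unfolding P_def by (intro pi_form T factorisation_form(2)) simp_all
  qed
  have P_Refl: "inhabited \<Delta> (P A d a a (Refl a))"
    if A: "\<Delta> \<turnstile> A \<Ztypecolon> Univ i" and a: "\<Delta> \<turnstile> a \<Ztypecolon> A" and d: "\<Delta> \<turnstile> d \<Ztypecolon> A" for \<Delta> A d a
  proof -
    have T: "\<Delta> \<turnstile> IdT A a d \<Ztypecolon> Univ i" using A a d by (rule id_form)
    note ctx = ctx_ext[OF T]
    have "IdT A a d # \<Delta> \<turnstile> Var 0 \<Ztypecolon> IdT (wk A) (wk a) (wk d)"
      by (rule var_typing[OF ctx]) simp_all
    then have "inhabited (IdT A a d # \<Delta>)
        (factorisation (wk A) (wk a) (wk a) (wk d) (Refl (wk a)) (Var 0))"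
      using A[THEN weaken1, OF ctx] a[THEN weaken1, OF ctx] d[THEN weaken1, OF ctx]
      by (intro inhabited_factorisation_Refl) simp_all
    then show ?thesis
      unfolding P_def by (intro inhabited_Pi[OF T]) simp
  qed
  have C: "IdT (wk (wk A)) (Var 1) (Var 0) # wk A # A # \<Gamma> \<turnstile>
      P (A\<langle>\<lambda>k. Var (Suc (Suc (Suc k)))\<rangle>) (d\<langle>\<lambda>k. Var (Suc (Suc (Suc k)))\<rangle>) (Var 2) (Var 1) (Var 0)
      \<Ztypecolon> Univ i"
    using weaken3[OF d path_ctx(3)[OF A]] by (intro P_form path_ctx_typing[OF A]) simp
  have "inhabited (A # \<Gamma>) (P (wk A) (wk d) (Var 0) (Var 0) (Refl (Var 0)))"
    using weaken1[OF A path_ctx(1)[OF A]] weaken1[OF d path_ctx(1)[OF A]]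
    by (intro P_Refl var_typing path_ctx[OF A]) simp_all
  then have "inhabited \<Gamma> (P A d a b p)"
    using inhabited_path_induct[OF C _ a b p] by (simp add: subst_P)
  then show ?thesis
    using inhabited_App[OF _ t] unfolding P_def by fastforce
qed

section \<open>Fixed points of an endomap\<close>

definition endomap :: "tm list \<Rightarrow> nat \<Rightarrow> tm \<Rightarrow> tm \<Rightarrow> bool" where
  "endomap \<Gamma> i X f \<longleftrightarrow> \<Gamma> \<turnstile> X \<Ztypecolon> Univ i \<and> \<Gamma> \<turnstile> f \<Ztypecolon> Arr X X"

lemma endomap_type: "endomap \<Gamma> i X f \<Longrightarrow> \<Gamma> \<turnstile> X \<Ztypecolon> Univ i"
  by (simp add: endomap_def)

lemma endomap_weaken:
  assumes "endomap \<Gamma> i X f" "is_ctx (\<Xi> @ \<Gamma>)"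
  shows "endomap (\<Xi> @ \<Gamma>) i (X\<langle>\<lambda>k. Var (k + length \<Xi>)\<rangle>) (f\<langle>\<lambda>k. Var (k + length \<Xi>)\<rangle>)"
  using assms weaken[of \<Gamma> _ _ \<Xi>] by (fastforce simp: endomap_def)

lemmas endomap_weaken1 = endomap_weaken[where \<Xi> = "[A]" for A, simplified]
lemmas endomap_weaken3 = endomap_weaken[where \<Xi> = "[C, B, A]" for A B C, simplified]

lemma endomap_app: "endomap \<Gamma> i X f \<Longrightarrow> \<Gamma> \<turnstile> a \<Ztypecolon> X \<Longrightarrow> \<Gamma> \<turnstile> App f a \<Ztypecolon> X"
  using pi_elim[of \<Gamma> f X "wk X" a] by (simp add: endomap_def)

lemma fixed_form:
  "endomap \<Gamma> i X f \<Longrightarrow> \<Gamma> \<turnstile> a \<Ztypecolon> X \<Longrightarrow> \<Gamma> \<turnstile> IdT X (App f a) a \<Ztypecolon> Univ i"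
  by (intro id_form endomap_app[where i = i] endomap_type)

definition Fix :: "tm \<Rightarrow> tm \<Rightarrow> tm" where
  "Fix X f = Sigma X (IdT (wk X) (App (wk f) (Var 0)) (Var 0))"

lemma subst_Fix [simp]: "(Fix X f)\<langle>\<sigma>\<rangle> = Fix (X\<langle>\<sigma>\<rangle>) (f\<langle>\<sigma>\<rangle>)"
  by (simp add: Fix_def)

lemma Fix_form:
  assumes "endomap \<Gamma> i X f"
  shows "X # \<Gamma> \<turnstile> IdT (wk X) (App (wk f) (Var 0)) (Var 0) \<Ztypecolon> Univ i"
    and "\<Gamma> \<turnstile> Fix X f \<Ztypecolon> Univ i"
proof -
  note X = endomap_type[OF assms]
  note ctx = ctx_ext[OF X]
  show *: "X # \<Gamma> \<turnstile> IdT (wk X) (App (wk f) (Var 0)) (Var 0) \<Ztypecolon> Univ i"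
    using endomap_weaken1[OF assms ctx] by (intro fixed_form var_typing ctx) simp_all
  show "\<Gamma> \<turnstile> Fix X f \<Ztypecolon> Univ i"
    unfolding Fix_def by (rule sigma_form[OF X *])
qed

lemma Fix_intro:
  assumes "endomap \<Gamma> i X f" "\<Gamma> \<turnstile> a \<Ztypecolon> X" "\<Gamma> \<turnstile> p \<Ztypecolon> IdT X (App f a) a"
  shows "\<Gamma> \<turnstile> Pr a p \<Ztypecolon> Fix X f"
  using assms unfolding Fix_def by (intro sigma_intro[OF Fix_form(1)]) simp_all

text \<open>Pairing with a fixed first component respects paths. The induction is on a path between
  paths: its ambient type is \<open>f y = y\<close>, and \<open>X\<close>, \<open>f\<close>,
  \<open>y\<close> enter the motive as weakened constants.\<close>

lemma inhabited_Fix_path: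
  assumes e: "endomap \<Gamma> i X f" and y: "\<Gamma> \<turnstile> y \<Ztypecolon> X"
    and p: "\<Gamma> \<turnstile> p \<Ztypecolon> IdT X (App f y) y" and q: "\<Gamma> \<turnstile> q \<Ztypecolon> IdT X (App f y) y"
    and pq: "\<Gamma> \<turnstile> t \<Ztypecolon> IdT (IdT X (App f y) y) p q"
  shows "inhabited \<Gamma> (IdT (Fix X f) (Pr y p) (Pr y q))"
proof -
  let ?T = "IdT X (App f y) y"
  have T: "\<Gamma> \<turnstile> ?T \<Ztypecolon> Univ i" using e y by (rule fixed_form)
  note ctx = path_ctx[OF T]
  let ?X = "X\<langle>\<lambda>k. Var (Suc (Suc (Suc k)))\<rangle>" and ?f = "f\<langle>\<lambda>k. Var (Suc (Suc (Suc k)))\<rangle>"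
    and ?y = "y\<langle>\<lambda>k. Var (Suc (Suc (Suc k)))\<rangle>"
  have C: "IdT (wk (wk ?T)) (Var 1) (Var 0) # wk ?T # ?T # \<Gamma> \<turnstile>
      IdT (Fix ?X ?f) (Pr ?y (Var 2)) (Pr ?y (Var 1)) \<Ztypecolon> Univ i"
    using endomap_weaken3[OF e ctx(3)] weaken3[OF y ctx(3)] path_ctx_typing[OF T]
    by (intro id_form Fix_form(2) Fix_intro[where i = i]) simp_all
  have v: "?T # \<Gamma> \<turnstile> Var 0 \<Ztypecolon> wk ?T"
    by (rule var_typing[OF ctx(1)]) simp_all
  have "?T # \<Gamma> \<turnstile> Refl (Pr (wk y) (Var 0)) \<Ztypecolon> IdT (Fix (wk X) (wk f)) (Pr (wk y) (Var 0)) (Pr (wk y) (Var 0))"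
    using endomap_weaken1[OF e ctx(1)] weaken1[OF y ctx(1)] v
    by (intro id_intro[where i = i] Fix_form(2) Fix_intro[where i = i]) simp_all
  then show ?thesis
    using inhabited_path_induct[OF C _ p q pq] by (simp add: inhabitedI)
qed

section \<open>Contracting fixed points along a cone\<close>

text \<open>A homotopy from \<open>f\<close> to the constant map at \<open>z\<close>.\<close>

definition cone :: "tm \<Rightarrow> tm \<Rightarrow> tm \<Rightarrow> tm" where
  "cone X f z = Pi X (IdT (wk X) (App (wk f) (Var 0)) (wk z))"

lemma subst_cone [simp]: "(cone X f z)\<langle>\<sigma>\<rangle> = cone (X\<langle>\<sigma>\<rangle>) (f\<langle>\<sigma>\<rangle>) (z\<langle>\<sigma>\<rangle>)"
  by (simp add: cone_def)

lemma cone_form: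
  assumes e: "endomap \<Gamma> i X f" and z: "\<Gamma> \<turnstile> z \<Ztypecolon> X"
  shows "\<Gamma> \<turnstile> cone X f z \<Ztypecolon> Univ i"
proof -
  note X = endomap_type[OF e]
  note ctx = ctx_ext[OF X]
  have "X # \<Gamma> \<turnstile> Var 0 \<Ztypecolon> wk X" by (rule var_typing[OF ctx]) simp_all
  then show ?thesis
    using endomap_weaken1[OF e ctx] weaken1[OF z ctx] weaken1[OF X ctx] unfolding cone_def
    by (intro pi_form X id_form endomap_app[where i = i]) simp_all
qed

lemma cone_app: "\<Gamma> \<turnstile> c \<Ztypecolon> cone X f z \<Longrightarrow> \<Gamma> \<turnstile> u \<Ztypecolon> X \<Longrightarrow> \<Gamma> \<turnstile> App c u \<Ztypecolon> IdT X (App f u) z"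
  using pi_elim[of \<Gamma> c X "IdT (wk X) (App (wk f) (Var 0)) (wk z)" u] by (simp add: cone_def)

text \<open>The equation in \<open>factorisation\<close> for \<open>p : f y = y\<close> and
  \<open>t = c y\<close>.\<close>

definition contraction_eq :: "tm \<Rightarrow> tm \<Rightarrow> tm \<Rightarrow> tm \<Rightarrow> tm \<Rightarrow> tm \<Rightarrow> tm \<Rightarrow> tm" where
  "contraction_eq X f y z s p c =
    IdT (IdT X (App f y) z) (path_comp X (App f y) y z p s) (App c y)"

lemma subst_contraction_eq [simp]: "(contraction_eq X f y z s p c)\<langle>\<sigma>\<rangle> =
    contraction_eq (X\<langle>\<sigma>\<rangle>) (f\<langle>\<sigma>\<rangle>) (y\<langle>\<sigma>\<rangle>) (z\<langle>\<sigma>\<rangle>) (s\<langle>\<sigma>\<rangle>) (p\<langle>\<sigma>\<rangle>) (c\<langle>\<sigma>\<rangle>)"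
  by (simp add: contraction_eq_def)

lemma contraction_eq_form:
  assumes e: "endomap \<Gamma> i X f" and y: "\<Gamma> \<turnstile> y \<Ztypecolon> X" and z: "\<Gamma> \<turnstile> z \<Ztypecolon> X" and s: "\<Gamma> \<turnstile> s \<Ztypecolon> IdT X y z"
    and p: "\<Gamma> \<turnstile> p \<Ztypecolon> IdT X (App f y) y" and c: "\<Gamma> \<turnstile> c \<Ztypecolon> cone X f z"
  shows "\<Gamma> \<turnstile> contraction_eq X f y z s p c \<Ztypecolon> Univ i"
  unfolding contraction_eq_def
  by (intro id_form path_comp_typing[where i = i] endomap_type[OF e] endomap_app[OF e]
      cone_app[OF c] y z s p)

text \<open>Since \<open>s\<close> is the second factor of the composite, putting
  \<open>Refl y\<close> for it leaves \<open>p\<close> judgementally.\<close>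

lemma contraction_eq_Refl:
  assumes e: "endomap \<Gamma> i X f" and y: "\<Gamma> \<turnstile> y \<Ztypecolon> X"
    and p: "\<Gamma> \<turnstile> p \<Ztypecolon> IdT X (App f y) y" and c: "\<Gamma> \<turnstile> c \<Ztypecolon> cone X f y"
  shows "\<Gamma> \<turnstile> contraction_eq X f y y (Refl y) p c \<doteq>
    IdT (IdT X (App f y) y) p (App c y) \<Ztypecolon> Univ i"
  unfolding contraction_eq_def
  by (intro id_form_cong eq_refl path_comp_Refl[where i = i] fixed_form cone_app[OF c] e y p
      endomap_type[OF e] endomap_app[OF e])

text \<open>In named notation, for \<open>s : y = z\<close>, this is the type
  \<open>\<Prod>p : f y = y. \<Prod>c : (\<Prod>u. f u = z). p \<bullet> s = c y \<rightarrow> (y, p) = (z, c z)\<close>.\<close>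

definition contraction :: "tm \<Rightarrow> tm \<Rightarrow> tm \<Rightarrow> tm \<Rightarrow> tm \<Rightarrow> tm" where
  "contraction X f y z s =
    Pi (IdT X (App f y) y)
      (Pi (cone (wk X) (wk f) (wk z))
        (Pi (contraction_eq (wk (wk X)) (wk (wk f)) (wk (wk y)) (wk (wk z)) (wk (wk s)) (Var 1) (Var 0))
          (IdT (Fix (wk (wk (wk X))) (wk (wk (wk f)))) (Pr (wk (wk (wk y))) (Var 2))
            (Pr (wk (wk (wk z))) (App (Var 1) (wk (wk (wk z))))))))"

lemma subst_contraction [simp]: "(contraction X f y z s)\<langle>\<sigma>\<rangle> =
    contraction (X\<langle>\<sigma>\<rangle>) (f\<langle>\<sigma>\<rangle>) (y\<langle>\<sigma>\<rangle>) (z\<langle>\<sigma>\<rangle>) (s\<langle>\<sigma>\<rangle>)"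
  by (simp add: contraction_def)

text \<open>The three domains of the iterated product, shared by its formation and by its
  reflexivity case.\<close>

lemma contraction_telescope:
  assumes e: "endomap \<Gamma> i X f" and y: "\<Gamma> \<turnstile> y \<Ztypecolon> X" and z: "\<Gamma> \<turnstile> z \<Ztypecolon> X" and s: "\<Gamma> \<turnstile> s \<Ztypecolon> IdT X y z"
  defines "P \<equiv> IdT X (App f y) y" and "C \<equiv> cone (wk X) (wk f) (wk z)"
    and "E \<equiv> contraction_eq (wk (wk X)) (wk (wk f)) (wk (wk y)) (wk (wk z)) (wk (wk s)) (Var 1) (Var 0)"
  shows "\<Gamma> \<turnstile> P \<Ztypecolon> Univ i" "P # \<Gamma> \<turnstile> C \<Ztypecolon> Univ i" "C # P # \<Gamma> \<turnstile> E \<Ztypecolon> Univ i"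
proof -
  show P: "\<Gamma> \<turnstile> P \<Ztypecolon> Univ i" unfolding P_def using e y by (rule fixed_form)
  note ctx1 = ctx_ext[OF P]
  show C: "P # \<Gamma> \<turnstile> C \<Ztypecolon> Univ i"
    unfolding C_def using endomap_weaken1[OF e ctx1] weaken1[OF z ctx1] by (intro cone_form) simp_all
  note ctx2 = ctx_ext[OF C]
  have "C # P # \<Gamma> \<turnstile> Var 1 \<Ztypecolon> wk (wk P)" "C # P # \<Gamma> \<turnstile> Var 0 \<Ztypecolon> wk C"
    by (rule var_typing[OF ctx2]; simp)+
  then show "C # P # \<Gamma> \<turnstile> E \<Ztypecolon> Univ i"
    unfolding E_def
    using endomap_weaken[OF e, of "[C, P]"] ctx2 weaken2[OF y ctx2] weaken2[OF z ctx2] weaken2[OF s ctx2]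
    by (intro contraction_eq_form) (simp_all add: P_def C_def)
qed

lemma contraction_form:
  assumes e: "endomap \<Gamma> i X f" and y: "\<Gamma> \<turnstile> y \<Ztypecolon> X" and z: "\<Gamma> \<turnstile> z \<Ztypecolon> X" and s: "\<Gamma> \<turnstile> s \<Ztypecolon> IdT X y z"
  shows "\<Gamma> \<turnstile> contraction X f y z s \<Ztypecolon> Univ i"
proof -
  note tele = contraction_telescope[OF e y z s]
  let ?\<Delta> = "contraction_eq (wk (wk X)) (wk (wk f)) (wk (wk y)) (wk (wk z)) (wk (wk s)) (Var 1) (Var 0)
    # cone (wk X) (wk f) (wk z) # IdT X (App f y) y # \<Gamma>"
  have ctx: "is_ctx ?\<Delta>" using tele(3) by (rule ctx_ext)
  have "?\<Delta> \<turnstile> Var 2 \<Ztypecolon> wk (wk (wk (IdT X (App f y) y)))" "?\<Delta> \<turnstile> Var 1 \<Ztypecolon> wk (wk (cone (wk X) (wk f) (wk z)))"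
    by (rule var_typing[OF ctx]; simp)+
  then show ?thesis
    unfolding contraction_def
    using endomap_weaken3[OF e ctx] weaken3[OF y ctx] weaken3[OF z ctx]
    by (intro pi_form tele id_form Fix_form(2) Fix_intro[where i = i] cone_app) simp_all
qed

text \<open>For the reflexivity path the equation converts to \<open>p = c y\<close>, and equal
  second components give equal pairs.\<close>

lemma inhabited_contraction_Refl:
  assumes e: "endomap \<Gamma> i X f" and y: "\<Gamma> \<turnstile> y \<Ztypecolon> X"
  shows "inhabited \<Gamma> (contraction X f y y (Refl y))"
proof -
  have r: "\<Gamma> \<turnstile> Refl y \<Ztypecolon> IdT X y y" using endomap_type[OF e] y by (rule id_intro)
  note tele = contraction_telescope[OF e y y r]
  let ?\<Delta> = "contraction_eq (wk (wk X)) (wk (wk f)) (wk (wk y)) (wk (wk y)) (wk (wk (Refl y))) (Var 1) (Var 0)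
    # cone (wk X) (wk f) (wk y) # IdT X (App f y) y # \<Gamma>"
  have ctx: "is_ctx ?\<Delta>" using tele(3) by (rule ctx_ext)
  let ?X = "wk (wk (wk X))" and ?f = "wk (wk (wk f))" and ?y = "wk (wk (wk y))"
  have e': "endomap ?\<Delta> i ?X ?f" and y': "?\<Delta> \<turnstile> ?y \<Ztypecolon> ?X"
    using endomap_weaken3[OF e ctx] weaken3[OF y ctx] by simp_all
  have p: "?\<Delta> \<turnstile> Var 2 \<Ztypecolon> IdT ?X (App ?f ?y) ?y" and c: "?\<Delta> \<turnstile> Var 1 \<Ztypecolon> cone ?X ?f ?y"
    and t: "?\<Delta> \<turnstile> Var 0 \<Ztypecolon> contraction_eq ?X ?f ?y ?y (Refl ?y) (Var 2) (Var 1)"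
    by (rule var_typing[OF ctx]; simp)+
  have "?\<Delta> \<turnstile> Var 0 \<Ztypecolon> IdT (IdT ?X (App ?f ?y) ?y) (Var 2) (App (Var 1) ?y)"
    using t contraction_eq_Refl[OF e' y' p c] by (rule conv)
  from inhabited_Fix_path[OF e' y' p cone_app[OF c y'] this]
  show ?thesis
    unfolding contraction_def by (intro inhabited_Pi[where i = i] tele)
qed

text \<open>Path induction on \<open>s\<close>. The types of \<open>p\<close>, \<open>c\<close> and
  the equation depend on the endpoints of \<open>s\<close>, which is why \<open>contraction\<close>
  quantifies over all three.\<close>

lemma inhabited_contraction:
  assumes e: "endomap \<Gamma> i X f" and y: "\<Gamma> \<turnstile> y \<Ztypecolon> X" and z: "\<Gamma> \<turnstile> z \<Ztypecolon> X" and s: "\<Gamma> \<turnstile> s \<Ztypecolon> IdT X y z"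
  shows "inhabited \<Gamma> (contraction X f y z s)"
proof -
  note X = endomap_type[OF e]
  have C: "IdT (wk (wk X)) (Var 1) (Var 0) # wk X # X # \<Gamma> \<turnstile>
      contraction (X\<langle>\<lambda>k. Var (Suc (Suc (Suc k)))\<rangle>) (f\<langle>\<lambda>k. Var (Suc (Suc (Suc k)))\<rangle>) (Var 2) (Var 1) (Var 0)
      \<Ztypecolon> Univ i"
    using endomap_weaken3[OF e path_ctx(3)[OF X]]
    by (intro contraction_form path_ctx_typing[OF X]) simp_all
  have "inhabited (X # \<Gamma>) (contraction (wk X) (wk f) (Var 0) (Var 0) (Refl (Var 0)))"
    using endomap_weaken1[OF e path_ctx(1)[OF X]]
    by (intro inhabited_contraction_Refl var_typing path_ctx[OF X]) simp_all
  then show ?thesis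
    using inhabited_path_induct[OF C _ y z s] by simp
qed

lemma contraction_app:
  assumes "inhabited \<Gamma> (contraction X f y z s)"
    and p: "\<Gamma> \<turnstile> p \<Ztypecolon> IdT X (App f y) y" and c: "\<Gamma> \<turnstile> c \<Ztypecolon> cone X f z"
    and q: "\<Gamma> \<turnstile> q \<Ztypecolon> contraction_eq X f y z s p c"
  shows "inhabited \<Gamma> (IdT (Fix X f) (Pr y p) (Pr z (App c z)))"
proof -
  have "inhabited \<Gamma> (Pi (cone X f z)
        (Pi (contraction_eq (wk X) (wk f) (wk y) (wk z) (wk s) (wk p) (Var 0))
          (IdT (Fix (wk (wk X)) (wk (wk f))) (Pr (wk (wk y)) (wk (wk p)))
            (Pr (wk (wk z)) (App (Var 1) (wk (wk z)))))))"
    using inhabited_App[OF assms(1)[unfolded contraction_def] p] by simp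
  from inhabited_App[OF this c]
  have "inhabited \<Gamma> (Pi (contraction_eq X f y z s p c)
          (IdT (Fix (wk X) (wk f)) (Pr (wk y) (wk p)) (Pr (wk z) (App (wk c) (wk z)))))"
    by simp
  from inhabited_App[OF this q] show ?thesis by simp
qed

text \<open>The path \<open>s\<close> from \<open>y\<close> to \<open>z\<close> is the inverse of \<open>p\<close> followed by \<open>c y\<close>.\<close>

lemma inhabited_Fix_cone:
  assumes e: "endomap \<Gamma> i X f" and y: "\<Gamma> \<turnstile> y \<Ztypecolon> X" and z: "\<Gamma> \<turnstile> z \<Ztypecolon> X"
    and p: "\<Gamma> \<turnstile> p \<Ztypecolon> IdT X (App f y) y" and c: "\<Gamma> \<turnstile> c \<Ztypecolon> cone X f z"
  shows "inhabited \<Gamma> (IdT (Fix X f) (Pr y p) (Pr z (App c z)))" (is "inhabited \<Gamma> ?G")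
proof -
  note X = endomap_type[OF e] and fy = endomap_app[OF e y] and t = cone_app[OF c y]
  let ?S = "IdT X y z"
  let ?E = "contraction_eq (wk X) (wk f) (wk y) (wk z) (Var 0) (wk p) (wk c)"
  \<comment> \<open>The factorisation of \<open>c y\<close> through \<open>p\<close> supplies
    exactly a path \<open>s\<close> together with the hypothesis that \<open>contraction\<close>
    asks for.\<close>
  have fact: "factorisation X (App f y) y z p (App c y) = Sigma ?S ?E"
    by (simp add: factorisation_def contraction_eq_def)
  have E: "?S # \<Gamma> \<turnstile> ?E \<Ztypecolon> Univ i"
    using factorisation_form(1)[OF X fy y z p t] by (simp add: contraction_eq_def)
  let ?\<Delta> = "?E # ?S # \<Gamma>"
  have ctx: "is_ctx ?\<Delta>" using E by (rule ctx_ext)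
  let ?X = "wk (wk X)" and ?f = "wk (wk f)" and ?y = "wk (wk y)" and ?z = "wk (wk z)"
    and ?p = "wk (wk p)" and ?c = "wk (wk c)"
  have w: "endomap ?\<Delta> i ?X ?f" "?\<Delta> \<turnstile> ?y \<Ztypecolon> ?X" "?\<Delta> \<turnstile> ?z \<Ztypecolon> ?X"
    "?\<Delta> \<turnstile> ?p \<Ztypecolon> IdT ?X (App ?f ?y) ?y" "?\<Delta> \<turnstile> ?c \<Ztypecolon> cone ?X ?f ?z"
    using endomap_weaken[OF e, of "[?E, ?S]"] ctx weaken2[OF y ctx] weaken2[OF z ctx]
      weaken2[OF p ctx] weaken2[OF c ctx] by simp_all
  have s: "?\<Delta> \<turnstile> Var 1 \<Ztypecolon> IdT ?X ?y ?z"
    and q: "?\<Delta> \<turnstile> Var 0 \<Ztypecolon> contraction_eq ?X ?f ?y ?z (Var 1) ?p ?c"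
    by (rule var_typing[OF ctx]; simp)+
  \<comment> \<open>First the goal is inhabited over a generic \<open>s\<close> and a generic proof
    of its equation; the Sigma eliminator with the constant motive \<open>wk ?G\<close> then feeds
    in the actual pair.\<close>
  obtain g where "?\<Delta> \<turnstile> g \<Ztypecolon> wk (wk ?G)"
    using contraction_app[OF inhabited_contraction[OF w(1-3) s] w(4,5) q]
    by (auto simp: inhabited_def)
  moreover have "Sigma ?S ?E # \<Gamma> \<turnstile> wk ?G \<Ztypecolon> Univ i"
  proof -
    have "\<Gamma> \<turnstile> ?G \<Ztypecolon> Univ i"
      by (intro id_form Fix_form(2)[OF e] Fix_intro[OF e] y z p cone_app[OF c])
    from weaken1[OF this ctx_ext[OF factorisation_form(2)[OF X fy y z p t]]]
    show ?thesis using fact by simp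
  qed
  moreover obtain h where "\<Gamma> \<turnstile> h \<Ztypecolon> Sigma ?S ?E"
    using inhabited_factorisation[OF X fy y z p t] fact by (auto simp: inhabited_def)
  ultimately have "\<Gamma> \<turnstile> SigmaInd (wk ?G) g h \<Ztypecolon> ?G"
    using sigma_elim[of ?S ?E \<Gamma> "wk ?G" i g h] by simp
  then show ?thesis by (rule inhabitedI)
qed

section \<open>Weak constancy makes the type of fixed points a proposition\<close>

definition wconst :: "tm \<Rightarrow> tm \<Rightarrow> tm" where
  "wconst X f = Pi X (Pi (wk X)
     (IdT (wk (wk X)) (App (wk (wk f)) (Var 1)) (App (wk (wk f)) (Var 0))))"

lemma subst_wconst [simp]: "(wconst X f)\<langle>\<sigma>\<rangle> = wconst (X\<langle>\<sigma>\<rangle>) (f\<langle>\<sigma>\<rangle>)"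
  by (simp add: wconst_def)

lemma wconst_app:
  assumes "\<Gamma> \<turnstile> W \<Ztypecolon> wconst X f" "\<Gamma> \<turnstile> a \<Ztypecolon> X" "\<Gamma> \<turnstile> b \<Ztypecolon> X"
  shows "\<Gamma> \<turnstile> App (App W a) b \<Ztypecolon> IdT X (App f a) (App f b)"
proof -
  have "\<Gamma> \<turnstile> App W a \<Ztypecolon> Pi X (IdT (wk X) (App (wk f) (wk a)) (App (wk f) (Var 0)))"
    using pi_elim[OF assms(1)[unfolded wconst_def] assms(2)] by simp
  from pi_elim[OF this assms(3)] show ?thesis by simp
qed

lemma wconst_cone:
  assumes e: "endomap \<Gamma> i X f" and W: "\<Gamma> \<turnstile> W \<Ztypecolon> wconst X f"
    and x: "\<Gamma> \<turnstile> x \<Ztypecolon> X" and p: "\<Gamma> \<turnstile> p \<Ztypecolon> IdT X (App f x) x"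
  shows "inhabited \<Gamma> (cone X f x)"
proof -
  note X = endomap_type[OF e]
  note ctx = ctx_ext[OF X]
  have w: "endomap (X # \<Gamma>) i (wk X) (wk f)" "X # \<Gamma> \<turnstile> wk x \<Ztypecolon> wk X"
      "X # \<Gamma> \<turnstile> wk W \<Ztypecolon> wconst (wk X) (wk f)"
      "X # \<Gamma> \<turnstile> wk p \<Ztypecolon> IdT (wk X) (App (wk f) (wk x)) (wk x)"
    using endomap_weaken1[OF e ctx] weaken1[OF x ctx] weaken1[OF W ctx] weaken1[OF p ctx]
    by simp_all
  have v: "X # \<Gamma> \<turnstile> Var 0 \<Ztypecolon> wk X" by (rule var_typing[OF ctx]) simp_all
  \<comment> \<open>At the generic point \<open>u\<close>, weak constancy gives
    \<open>f u = f x\<close>, and \<open>p\<close> continues it to \<open>x\<close>.\<close>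
  from path_comp_typing[OF endomap_type[OF w(1)] endomap_app[OF w(1) v] endomap_app[OF w(1,2)] w(2)
      wconst_app[OF w(3) v w(2)] w(4)]
  show ?thesis
    unfolding cone_def by (intro inhabited_Pi[OF X]) (rule inhabitedI)
qed

lemma inhabited_Fix_prop:
  assumes e: "endomap \<Gamma> i X f" and W: "\<Gamma> \<turnstile> W \<Ztypecolon> wconst X f"
    and x: "\<Gamma> \<turnstile> x \<Ztypecolon> X" and p: "\<Gamma> \<turnstile> p \<Ztypecolon> IdT X (App f x) x"
    and y: "\<Gamma> \<turnstile> y \<Ztypecolon> X" and q: "\<Gamma> \<turnstile> q \<Ztypecolon> IdT X (App f y) y"
  shows "inhabited \<Gamma> (IdT (Fix X f) (Pr y q) (Pr x p))"
proof -
  obtain c where c: "\<Gamma> \<turnstile> c \<Ztypecolon> cone X f x"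
    using wconst_cone[OF e W x p] by (auto simp: inhabited_def)
  show ?thesis
    \<comment> \<open>The common target is \<open>(x, c x)\<close>. The proof \<open>p\<close> may
      differ from \<open>c x\<close>, so \<open>(x, p)\<close> also needs its own instance of
      \<open>inhabited_Fix_cone\<close>, with \<open>x\<close> in place of \<open>y\<close>.\<close>
    by (rule path_cotrans[OF Fix_form(2)[OF e] Fix_intro[OF e y q] Fix_intro[OF e x p]
          Fix_intro[OF e x cone_app[OF c x]] inhabited_Fix_cone[OF e y x q c]
          inhabited_Fix_cone[OF e x x p c]])
qed

section \<open>The splitting\<close>

definition idem :: "tm \<Rightarrow> tm \<Rightarrow> tm" where
  "idem X f = Pi X (IdT (wk X) (App (wk f) (App (wk f) (Var 0))) (App (wk f) (Var 0)))"

lemma subst_idem [simp]: "(idem X f)\<langle>\<sigma>\<rangle> = idem (X\<langle>\<sigma>\<rangle>) (f\<langle>\<sigma>\<rangle>)"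
  by (simp add: idem_def)

lemma idem_app:
  "\<Gamma> \<turnstile> I \<Ztypecolon> idem X f \<Longrightarrow> \<Gamma> \<turnstile> a \<Ztypecolon> X \<Longrightarrow> \<Gamma> \<turnstile> App I a \<Ztypecolon> IdT X (App f (App f a)) (App f a)"
  using pi_elim[of \<Gamma> I X "IdT (wk X) (App (wk f) (App (wk f) (Var 0))) (App (wk f) (Var 0))" a]
  by (simp add: idem_def)

section \<open>The retraction and the section with their computation rules\<close>

definition retr :: "tm \<Rightarrow> tm \<Rightarrow> tm \<Rightarrow> tm" where
  "retr X f I = Lam X (Pr (App (wk f) (Var 0)) (App (wk I) (Var 0)))"

text \<open>The first projection, written with the eliminator: the motive is constant and
  \<open>Var 1\<close> is the first component in the branch.\<close>

definition sect :: "tm \<Rightarrow> tm \<Rightarrow> tm" where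
  "sect X f = Lam (Fix X f) (SigmaInd (wk (wk X)) (Var 1) (Var 0))"

lemma subst_retr [simp]: "(retr X f I)\<langle>\<sigma>\<rangle> = retr (X\<langle>\<sigma>\<rangle>) (f\<langle>\<sigma>\<rangle>) (I\<langle>\<sigma>\<rangle>)"
  and subst_sect [simp]: "(sect X f)\<langle>\<sigma>\<rangle> = sect (X\<langle>\<sigma>\<rangle>) (f\<langle>\<sigma>\<rangle>)"
  by (simp_all add: retr_def sect_def)

lemma retr_body:
  assumes e: "endomap \<Gamma> i X f" and I: "\<Gamma> \<turnstile> I \<Ztypecolon> idem X f"
  shows "X # \<Gamma> \<turnstile> Pr (App (wk f) (Var 0)) (App (wk I) (Var 0)) \<Ztypecolon> wk (Fix X f)"
proof -
  note ctx = ctx_ext[OF endomap_type[OF e]]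
  have e': "endomap (X # \<Gamma>) i (wk X) (wk f)" and I': "X # \<Gamma> \<turnstile> wk I \<Ztypecolon> idem (wk X) (wk f)"
    using endomap_weaken1[OF e ctx] weaken1[OF I ctx] by simp_all
  have v: "X # \<Gamma> \<turnstile> Var 0 \<Ztypecolon> wk X" by (rule var_typing[OF ctx]) simp_all
  show ?thesis
    using Fix_intro[OF e' endomap_app[OF e' v] idem_app[OF I' v]] by simp
qed

lemma retr_typing:
  "endomap \<Gamma> i X f \<Longrightarrow> \<Gamma> \<turnstile> I \<Ztypecolon> idem X f \<Longrightarrow> \<Gamma> \<turnstile> retr X f I \<Ztypecolon> Arr X (Fix X f)"
  unfolding retr_def by (rule pi_intro[OF endomap_type retr_body])

lemma retr_beta:
  assumes "endomap \<Gamma> i X f" "\<Gamma> \<turnstile> I \<Ztypecolon> idem X f" "\<Gamma> \<turnstile> a \<Ztypecolon> X"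
  shows "\<Gamma> \<turnstile> App (retr X f I) a \<doteq> Pr (App f a) (App I a) \<Ztypecolon> Fix X f"
  using pi_comp[OF retr_body[OF assms(1,2)] assms(3)] by (simp add: retr_def)

lemma sect_motive:
  assumes "endomap \<Gamma> i X f"
  shows "Fix X f # \<Gamma> \<turnstile> wk X \<Ztypecolon> Univ i"
  using weaken1[OF endomap_type[OF assms] ctx_ext[OF Fix_form(2)[OF assms]]] by simp

lemma sect_branch:
  assumes "endomap \<Gamma> i X f"
  shows "IdT (wk X) (App (wk f) (Var 0)) (Var 0) # X # \<Gamma> \<turnstile> Var 1 \<Ztypecolon> wk (wk X)"
  by (rule var_typing[OF ctx_ext[OF Fix_form(1)[OF assms]]]) simp_all

lemma Fix_fst:
  assumes e: "endomap \<Gamma> i X f" and a: "\<Gamma> \<turnstile> a \<Ztypecolon> Fix X f"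
  shows "\<Gamma> \<turnstile> SigmaInd (wk X) (Var 1) a \<Ztypecolon> X"
  using sigma_elim[OF sect_motive[OF e, unfolded Fix_def] _ a[unfolded Fix_def], of "Var 1"]
    sect_branch[OF e] by simp

lemma sect_body:
  assumes e: "endomap \<Gamma> i X f"
  shows "Fix X f # \<Gamma> \<turnstile> SigmaInd (wk (wk X)) (Var 1) (Var 0) \<Ztypecolon> wk X"
proof -
  note ctx = ctx_ext[OF Fix_form(2)[OF e]]
  have "Fix X f # \<Gamma> \<turnstile> Var 0 \<Ztypecolon> Fix (wk X) (wk f)" by (rule var_typing[OF ctx]) simp_all
  then show ?thesis
    using Fix_fst[of "Fix X f # \<Gamma>" i "wk X" "wk f"] endomap_weaken1[OF e ctx] by simp
qed

lemma sect_typing: "endomap \<Gamma> i X f \<Longrightarrow> \<Gamma> \<turnstile> sect X f \<Ztypecolon> Arr (Fix X f) X"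
  unfolding sect_def by (rule pi_intro[OF Fix_form(2) sect_body])

lemma sect_beta:
  assumes e: "endomap \<Gamma> i X f" and a: "\<Gamma> \<turnstile> a \<Ztypecolon> X" and p: "\<Gamma> \<turnstile> p \<Ztypecolon> IdT X (App f a) a"
  shows "\<Gamma> \<turnstile> App (sect X f) (Pr a p) \<doteq> a \<Ztypecolon> X"
proof -
  have "\<Gamma> \<turnstile> App (sect X f) (Pr a p) \<doteq> SigmaInd (wk X) (Var 1) (Pr a p) \<Ztypecolon> X"
    using pi_comp[OF sect_body[OF e] Fix_intro[OF e a p]] by (simp add: sect_def)
  moreover have "\<Gamma> \<turnstile> SigmaInd (wk X) (Var 1) (Pr a p) \<doteq> a \<Ztypecolon> X"
    using sigma_comp[OF sect_motive[OF e, unfolded Fix_def] _ a, of "Var 1" p] sect_branch[OF e] p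
    by simp
  ultimately show ?thesis by (rule eq_trans)
qed

lemma sect_app: "endomap \<Gamma> i X f \<Longrightarrow> \<Gamma> \<turnstile> a \<Ztypecolon> Fix X f \<Longrightarrow> \<Gamma> \<turnstile> App (sect X f) a \<Ztypecolon> X"
  using pi_elim[of \<Gamma> "sect X f" "Fix X f" "wk X" a] sect_typing[of \<Gamma> i X f] by simp

lemma retr_app:
  "endomap \<Gamma> i X f \<Longrightarrow> \<Gamma> \<turnstile> I \<Ztypecolon> idem X f \<Longrightarrow> \<Gamma> \<turnstile> a \<Ztypecolon> X \<Longrightarrow> \<Gamma> \<turnstile> App (retr X f I) a \<Ztypecolon> Fix X f"
  using pi_elim[of \<Gamma> "retr X f I" X "wk (Fix X f)" a] retr_typing[of \<Gamma> i X f I] by simp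

section \<open>The two homotopies\<close>

text \<open>Both maps compute: \<open>r x\<close> becomes the pair \<open>(f x, I x)\<close> and its
  projection is \<open>f x\<close>. So a reflexivity proof converts to the required type.\<close>

lemma sect_retr:
  assumes e: "endomap \<Gamma> i X f" and I: "\<Gamma> \<turnstile> I \<Ztypecolon> idem X f" and x: "\<Gamma> \<turnstile> x \<Ztypecolon> X"
  shows "inhabited \<Gamma> (IdT X (App (sect X f) (App (retr X f I) x)) (App f x))"
proof -
  note fx = endomap_app[OF e x] and X = endomap_type[OF e]
  have "\<Gamma> \<turnstile> App (sect X f) (App (retr X f I) x) \<doteq> App (sect X f) (Pr (App f x) (App I x)) \<Ztypecolon> X"
    using pi_elim_cong[OF eq_refl[OF sect_typing[OF e]] retr_beta[OF e I x]] by simp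
  note eq = eq_trans[OF this sect_beta[OF e fx idem_app[OF I x]]]
  have "\<Gamma> \<turnstile> IdT X (App f x) (App f x) \<doteq> IdT X (App (sect X f) (App (retr X f I) x)) (App f x) \<Ztypecolon> Univ i"
    by (intro id_form_cong eq_refl X fx eq_sym[OF eq])
  from conv[OF id_intro[OF X fx] this] show ?thesis by (rule inhabitedI)
qed

text \<open>On a pair, \<open>r (s (x, p))\<close> computes to \<open>(f x, I x)\<close>, so what
  remains is an equality between two elements of \<open>Fix X f\<close>.\<close>

lemma retr_sect_Pr:
  assumes e: "endomap \<Gamma> i X f" and I: "\<Gamma> \<turnstile> I \<Ztypecolon> idem X f" and W: "\<Gamma> \<turnstile> W \<Ztypecolon> wconst X f"
    and x: "\<Gamma> \<turnstile> x \<Ztypecolon> X" and p: "\<Gamma> \<turnstile> p \<Ztypecolon> IdT X (App f x) x"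
  shows "inhabited \<Gamma> (IdT (Fix X f) (App (retr X f I) (App (sect X f) (Pr x p))) (Pr x p))"
proof -
  note xp = Fix_intro[OF e x p]
  have "\<Gamma> \<turnstile> App (retr X f I) (App (sect X f) (Pr x p)) \<doteq> App (retr X f I) x \<Ztypecolon> Fix X f"
    using pi_elim_cong[OF eq_refl[OF retr_typing[OF e I]] sect_beta[OF e x p]] by simp
  note eq = eq_trans[OF this retr_beta[OF e I x]]
  have "\<Gamma> \<turnstile> IdT (Fix X f) (Pr (App f x) (App I x)) (Pr x p) \<doteq>
      IdT (Fix X f) (App (retr X f I) (App (sect X f) (Pr x p))) (Pr x p) \<Ztypecolon> Univ i"
    by (intro id_form_cong eq_refl Fix_form(2)[OF e] xp eq_sym[OF eq])
  \<comment> \<open>\<open>I x : f (f x) = f x\<close> is precisely the proof that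
    \<open>f x\<close> is a fixed point.\<close>
  moreover obtain t where "\<Gamma> \<turnstile> t \<Ztypecolon> IdT (Fix X f) (Pr (App f x) (App I x)) (Pr x p)"
    using inhabited_Fix_prop[OF e W x p endomap_app[OF e x] idem_app[OF I x]]
    by (auto simp: inhabited_def)
  ultimately show ?thesis by (intro inhabitedI[OF conv])
qed

text \<open>The section computes only on pairs, so the case of a general \<open>a\<close> is reduced
  to \<open>retr_sect_Pr\<close> by Sigma induction with the homotopy statement itself as
  motive.\<close>

lemma retr_sect:
  assumes e: "endomap \<Gamma> i X f" and I: "\<Gamma> \<turnstile> I \<Ztypecolon> idem X f" and W: "\<Gamma> \<turnstile> W \<Ztypecolon> wconst X f"
    and a: "\<Gamma> \<turnstile> a \<Ztypecolon> Fix X f"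
  shows "inhabited \<Gamma> (IdT (Fix X f) (App (retr X f I) (App (sect X f) a)) a)"
proof -
  let ?C = "IdT (Fix (wk X) (wk f))
    (App (retr (wk X) (wk f) (wk I)) (App (sect (wk X) (wk f)) (Var 0))) (Var 0)"
  have C: "Fix X f # \<Gamma> \<turnstile> ?C \<Ztypecolon> Univ i"
  proof -
    note ctx = ctx_ext[OF Fix_form(2)[OF e]]
    have e': "endomap (Fix X f # \<Gamma>) i (wk X) (wk f)"
      and I': "Fix X f # \<Gamma> \<turnstile> wk I \<Ztypecolon> idem (wk X) (wk f)"
      using endomap_weaken1[OF e ctx] weaken1[OF I ctx] by simp_all
    have v: "Fix X f # \<Gamma> \<turnstile> Var 0 \<Ztypecolon> Fix (wk X) (wk f)" by (rule var_typing[OF ctx]) simp_all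
    show ?thesis
      by (intro id_form Fix_form(2)[OF e'] retr_app[OF e' I'] sect_app[OF e'] v)
  qed
  let ?P = "IdT (wk X) (App (wk f) (Var 0)) (Var 0)"
  let ?\<Delta> = "?P # X # \<Gamma>"
  have ctx: "is_ctx ?\<Delta>" using Fix_form(1)[OF e] by (rule ctx_ext)
  have w: "endomap ?\<Delta> i (wk (wk X)) (wk (wk f))" "?\<Delta> \<turnstile> wk (wk I) \<Ztypecolon> idem (wk (wk X)) (wk (wk f))"
      "?\<Delta> \<turnstile> wk (wk W) \<Ztypecolon> wconst (wk (wk X)) (wk (wk f))"
    using endomap_weaken[OF e, of "[?P, X]"] ctx weaken2[OF I ctx] weaken2[OF W ctx] by simp_all
  have v: "?\<Delta> \<turnstile> Var 1 \<Ztypecolon> wk (wk X)" "?\<Delta> \<turnstile> Var 0 \<Ztypecolon> IdT (wk (wk X)) (App (wk (wk f)) (Var 1)) (Var 1)"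
    by (rule var_typing[OF ctx]; simp)+
  obtain g where "?\<Delta> \<turnstile> g \<Ztypecolon> ?C\<langle>Pr (Var 1) (Var 0) \<cdot> (\<lambda>k. Var (k + 2))\<rangle>"
    using retr_sect_Pr[OF w v] by (auto simp: inhabited_def)
  from sigma_elim[OF C[unfolded Fix_def] this[unfolded Fix_def] a[unfolded Fix_def]]
  show ?thesis by (intro inhabitedI[of _ "SigmaInd ?C g a"]) (simp add: Fix_def)
qed

theorem theorem3p9:
  fixes \<Gamma> :: "tm list" and X f I W :: tm and i :: nat
  assumes "\<Gamma> \<turnstile> X \<Ztypecolon> Univ i"
    and "\<Gamma> \<turnstile> f \<Ztypecolon> Arr X X"
    and "\<Gamma> \<turnstile> I \<Ztypecolon> Pi X (IdT (wk X) (App (wk f) (App (wk f) (Var 0))) (App (wk f) (Var 0)))"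
    and "\<Gamma> \<turnstile> W \<Ztypecolon> Pi X (Pi (wk X)
           (IdT (wk (wk X)) (App (wk (wk f)) (Var 1)) (App (wk (wk f)) (Var 0))))"
  shows "\<exists>A r s H K.
           (\<Gamma> \<turnstile> A \<Ztypecolon> Univ i) \<and>
           (\<Gamma> \<turnstile> r \<Ztypecolon> Arr X A) \<and>
           (\<Gamma> \<turnstile> s \<Ztypecolon> Arr A X) \<and>
           (\<Gamma> \<turnstile> H \<Ztypecolon> Pi A (IdT (wk A) (App (wk r) (App (wk s) (Var 0))) (Var 0))) \<and>
           (\<Gamma> \<turnstile> K \<Ztypecolon> Pi X (IdT (wk X) (App (wk s) (App (wk r) (Var 0))) (App (wk f) (Var 0))))"
proof -
  have e: "endomap \<Gamma> i X f" using assms by (simp add: endomap_def)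
  have I: "\<Gamma> \<turnstile> I \<Ztypecolon> idem X f" and W: "\<Gamma> \<turnstile> W \<Ztypecolon> wconst X f"
    using assms(3,4) by (simp_all only: idem_def wconst_def)
  let ?A = "Fix X f" and ?r = "retr X f I" and ?s = "sect X f"
  \<comment> \<open>The homotopy is \<open>retr_sect\<close> at the generic element
    \<open>Var 0\<close>; all data are weakened by one variable, and \<open>retr\<close> and
    \<open>sect\<close> commute with this weakening. \<open>K\<close> is obtained in the same way
    from \<open>sect_retr\<close>.\<close>
  have H: "inhabited \<Gamma> (Pi ?A (IdT (wk ?A) (App (wk ?r) (App (wk ?s) (Var 0))) (Var 0)))"
  proof (rule inhabited_Pi[OF Fix_form(2)[OF e]])
    note ctx = ctx_ext[OF Fix_form(2)[OF e]]
    have "?A # \<Gamma> \<turnstile> Var 0 \<Ztypecolon> Fix (wk X) (wk f)" by (rule var_typing[OF ctx]) simp_all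
    then show "inhabited (?A # \<Gamma>) (IdT (wk ?A) (App (wk ?r) (App (wk ?s) (Var 0))) (Var 0))"
      using retr_sect[of "?A # \<Gamma>" i "wk X" "wk f" "wk I" "wk W" "Var 0"]
        endomap_weaken1[OF e ctx] weaken1[OF I ctx] weaken1[OF W ctx] by simp
  qed
  have K: "inhabited \<Gamma> (Pi X (IdT (wk X) (App (wk ?s) (App (wk ?r) (Var 0))) (App (wk f) (Var 0))))"
  proof (rule inhabited_Pi[OF endomap_type[OF e]])
    note ctx = ctx_ext[OF endomap_type[OF e]]
    have "X # \<Gamma> \<turnstile> Var 0 \<Ztypecolon> wk X" by (rule var_typing[OF ctx]) simp_all
    then show "inhabited (X # \<Gamma>) (IdT (wk X) (App (wk ?s) (App (wk ?r) (Var 0))) (App (wk f) (Var 0)))"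
      using sect_retr[of "X # \<Gamma>" i "wk X" "wk f" "wk I" "Var 0"]
        endomap_weaken1[OF e ctx] weaken1[OF I ctx] by simp
  qed
  obtain h k where "\<Gamma> \<turnstile> h \<Ztypecolon> Pi ?A (IdT (wk ?A) (App (wk ?r) (App (wk ?s) (Var 0))) (Var 0))"
    and "\<Gamma> \<turnstile> k \<Ztypecolon> Pi X (IdT (wk X) (App (wk ?s) (App (wk ?r) (Var 0))) (App (wk f) (Var 0)))"
    using H K unfolding inhabited_def by (elim exE)
  with Fix_form(2)[OF e] retr_typing[OF e I] sect_typing[OF e] show ?thesis
    by (intro exI conjI)
qed

end
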